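(* For integers $m,n\ge 2$, $\Delta_2^t(K_m\,\square\, P_n)\simeq \bigvee_{(m-1)(n-1)}\mathbb{S}^{mn-4}$, a wedge of $(m-1)(n-1)$ spheres of dimension $mn-4$.
   Context: All graphs are finite and simple. For a graph $G$, the total $2$-cut complex $\Delta_2^t(G)$ is the simplicial complex on vertex set $V(G)$ whose facets are the subsets $\sigma\subseteq V(G)$ with $|\sigma|=|V(G)|-2$ such that the induced subgraph $G[V(G)\setminus\sigma]$ has no edge. $K_m$ is the complete graph on $m$ vertices and $P_n$ the path graph with vertices $0,\dots,n-1$ and edges $\{i,i+1\}$, $0\le i\le n-2$. The Cartesian product $G\,\square\, H$ has vertex set $V(G)\times V(H)$, with $(u_1,v_1)\sim(u_2,v_2)$ iff either $u_1=u_2$ and $v_1v_2\in E(H)$, or $v_1=v_2$ and $u_1u_2\in E(G)$. $\simeq$ denotes homotopy equivalence. *)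

theory Defs
  imports "HOL-Homology.Homology" "Graph_Theory.Graph_Theory"
begin

text \<open>Finite simple graphs are the symmetric loop-free digraphs without parallel arcs of
  \<^locale>\<open>pair_graph\<close>: an undirected edge $uv$ is the pair of arcs $(u,v)$, $(v,u)$.\<close>

definition complete_graph :: "nat \<Rightarrow> nat pair_pre_digraph" where
  "complete_graph m = \<lparr>pverts = {..<m}, parcs = {(u, v). u < m \<and> v < m \<and> u \<noteq> v}\<rparr>"

definition path_graph :: "nat \<Rightarrow> nat pair_pre_digraph" where
  "path_graph n =
     \<lparr>pverts = {..<n}, parcs = {(u, v). u < n \<and> v < n \<and> (v = Suc u \<or> u = Suc v)}\<rparr>"

definition cartesian_product ::
  "'a pair_pre_digraph \<Rightarrow> 'b pair_pre_digraph \<Rightarrow> ('a \<times> 'b) pair_pre_digraph"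
  (infixr \<open>\<box>\<close> 70) where
  "G \<box> H =
     \<lparr>pverts = pverts G \<times> pverts H,
      parcs = {((u1, v1), (u2, v2)).
                 (u1 = u2 \<and> u1 \<in> pverts G \<and> (v1, v2) \<in> parcs H) \<or>
                 (v1 = v2 \<and> v1 \<in> pverts H \<and> (u1, u2) \<in> parcs G)}\<rparr>"

lemma complete_graph_is_complete: "complete_digraph m (with_proj (complete_graph m))"
  unfolding complete_digraph_pair_def by (auto simp: complete_graph_def)

lemma pair_graph_complete_graph: "pair_graph (complete_graph m)"
  using complete_graph_is_complete by (rule pair_graphI_complete)

lemma pair_graph_path_graph: "pair_graph (path_graph n)"
proof unfold_locales
  have "parcs (path_graph n) \<subseteq> {..<n} \<times> {..<n}"
    by (auto simp: path_graph_def)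
  then show "finite (parcs (path_graph n))"
    by (rule finite_subset) simp
qed (auto simp: path_graph_def symmetric_def sym_def)

lemma pair_graph_cartesian_product:
  assumes "pair_graph G" and "pair_graph H"
  shows "pair_graph (G \<box> H)"
proof -
  interpret G: pair_graph G by fact
  interpret H: pair_graph H by fact
  have sub: "parcs (G \<box> H) \<subseteq> (pverts G \<times> pverts H) \<times> (pverts G \<times> pverts H)"
    by (auto simp: cartesian_product_def dest: G.wellformed' H.wellformed')
  have sym: "sym (parcs G)" "sym (parcs H)"
    using G.pair_sym_arcs H.pair_sym_arcs by (simp_all add: symmetric_def)
  show ?thesis
  proof unfold_locales
    show "finite (parcs (G \<box> H))"
      using sub by (rule finite_subset) (simp add: G.pair_finite_verts H.pair_finite_verts)
    show "finite (pverts (G \<box> H))"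
      by (simp add: cartesian_product_def G.pair_finite_verts H.pair_finite_verts)
    show "symmetric (with_proj (G \<box> H))"
      using sym by (auto simp: symmetric_def cartesian_product_def sym_def)
  next
    fix e assume e: "e \<in> parcs (G \<box> H)"
    show "fst e \<in> pverts (G \<box> H)" "snd e \<in> pverts (G \<box> H)"
      using e by (auto simp: cartesian_product_def dest: G.wellformed' H.wellformed')
    show "fst e \<noteq> snd e"
      using e by (auto simp: cartesian_product_def dest: G.pair_no_loops H.pair_no_loops)
  qed
qed

text \<open>An abstract simplicial complex is given by its set of faces (including the empty face).
  The generating sets below all have the same cardinality, so they are exactly the facets.\<close>

definition total_2cut_facets :: "'a pair_pre_digraph \<Rightarrow> 'a set set" where
  "total_2cut_facets G =
     {\<sigma>. \<sigma> \<subseteq> pverts G \<and> card \<sigma> + 2 = card (pverts G) \<and>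
         arcs (with_proj G \<restriction> (pverts G - \<sigma>)) = {}}"

definition total_2cut_complex :: "'a pair_pre_digraph \<Rightarrow> 'a set set" where
  "total_2cut_complex G = {\<tau>. \<exists>\<sigma> \<in> total_2cut_facets G. \<tau> \<subseteq> \<sigma>}"

text \<open>Points of the realization are given by their barycentric coordinates, extended by $0$
  to the whole vertex type. The product topology is the right one for finite complexes only.\<close>

definition geometric_realization :: "'a set set \<Rightarrow> ('a \<Rightarrow> real) topology" where
  "geometric_realization K =
     subtopology (powertop_real UNIV)
       {x. (\<forall>v. 0 \<le> x v) \<and> {v. x v \<noteq> 0} \<in> K \<and> (\<Sum>v | x v \<noteq> 0. x v) = 1}"

definition quotient_topology :: "'a topology \<Rightarrow> ('a \<Rightarrow> 'b) \<Rightarrow> 'b topology" where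
  "quotient_topology X q =
     topology (\<lambda>U. U \<subseteq> q ` topspace X \<and> openin X {x \<in> topspace X. q x \<in> U})"

lemma openin_quotient_topology:
  "openin (quotient_topology X q) U \<longleftrightarrow>
     U \<subseteq> q ` topspace X \<and> openin X {x \<in> topspace X. q x \<in> U}"
proof -
  have "istopology (\<lambda>U. U \<subseteq> q ` topspace X \<and> openin X {x \<in> topspace X. q x \<in> U})"
    unfolding istopology_def
  proof (intro conjI allI impI)
    fix S T
    assume S: "S \<subseteq> q ` topspace X \<and> openin X {x \<in> topspace X. q x \<in> S}"
      and T: "T \<subseteq> q ` topspace X \<and> openin X {x \<in> topspace X. q x \<in> T}"
    show "S \<inter> T \<subseteq> q ` topspace X" using S by blast
    have "{x \<in> topspace X. q x \<in> S \<inter> T} =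
        {x \<in> topspace X. q x \<in> S} \<inter> {x \<in> topspace X. q x \<in> T}" by blast
    then show "openin X {x \<in> topspace X. q x \<in> S \<inter> T}"
      using S T by (simp add: openin_Int)
  next
    fix \<K>
    assume K: "\<forall>U\<in>\<K>. U \<subseteq> q ` topspace X \<and> openin X {x \<in> topspace X. q x \<in> U}"
    then show "\<Union>\<K> \<subseteq> q ` topspace X" by blast
    have "{x \<in> topspace X. q x \<in> \<Union>\<K>} = (\<Union>U\<in>\<K>. {x \<in> topspace X. q x \<in> U})" by blast
    then show "openin X {x \<in> topspace X. q x \<in> \<Union>\<K>}"
      using K by auto
  qed
  then show ?thesis
    unfolding quotient_topology_def by (subst topology_inverse') auto
qed

lemma topspace_quotient_topology: "topspace (quotient_topology X q) = q ` topspace X"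
proof
  show "topspace (quotient_topology X q) \<subseteq> q ` topspace X"
    using openin_topspace[of "quotient_topology X q"] by (simp only: openin_quotient_topology)
  have "{x \<in> topspace X. q x \<in> q ` topspace X} = topspace X" by blast
  then show "q ` topspace X \<subseteq> topspace (quotient_topology X q)"
    by (intro openin_subset) (simp add: openin_quotient_topology)
qed

lemma quotient_map_quotient_topology: "quotient_map X (quotient_topology X q) q"
  by (simp add: quotient_map_def topspace_quotient_topology openin_quotient_topology)

text \<open>The wedge of the pointed spaces $(X_i, p_i)$, $i \in I$, for nonempty $I$: \<^const>\<open>None\<close> is
  the common base point and \<^term>\<open>Some (i, x)\<close> is the point $x \neq p_i$ of the $i$-th summand.\<close>

definition wedge :: "('i \<Rightarrow> 'a topology) \<Rightarrow> ('i \<Rightarrow> 'a) \<Rightarrow> 'i set \<Rightarrow> ('i \<times> 'a) option topology" where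
  "wedge X p I =
     quotient_topology (sum_topology X I) (\<lambda>(i, x). if x = p i then None else Some (i, x))"

definition nsphere_base :: "nat \<Rightarrow> real" where
  "nsphere_base = (\<lambda>i. if i = 0 then 1 else 0)"

lemma nsphere_base_in_nsphere: "nsphere_base \<in> topspace (nsphere d)"
  by (simp add: nsphere nsphere_base_def if_distrib[where f = "\<lambda>x. x ^ 2"] cong: if_cong)

definition wedge_of_spheres :: "nat \<Rightarrow> nat \<Rightarrow> (nat \<times> (nat \<Rightarrow> real)) option topology" where
  "wedge_of_spheres k d = wedge (\<lambda>_. nsphere d) (\<lambda>_. nsphere_base) {..<k}"

end

theory Submission
  imports Defs "HOL-Analysis.Abstract_Topological_Spaces"
begin

text \<open>A set $\tau$ is a face of $\Delta_2^t(G)$ iff $V \setminus \tau$ is not a clique, so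
  $\Delta_2^t(G)$ is the Alexander dual $D(C)$ of the clique complex $C$ of $G$. If $C$ restricted to
  $S \subsetneq V$ is a cone, then adding all subsets of $S$ to $C$ collapses $D(C)$ and preserves its
  homotopy type. For $G = K_m \mathbin{\square} P_n$ we fill in this way, for each $i$, the
  simplex spanned by layer $i + 1$ and the vertex $(0, i)$. The result $C_1$ lacks the
  $(m - 1)(n - 1)$ triangles $T_{u,i} = \{(0, i), (u, i), (u, i + 1)\}$, $u \ge 1$, but contains
  their boundaries. Adding the triangles gives a complex $C'$ that becomes a cone after
  further fillings, so $D(C')$ is contractible; and $D(C_1)$ is $D(C')$ with the
  $(mn - 4)$-dimensional cells $V \setminus T_{u,i}$ attached. Collapsing $D(C')$ to a point gives the
  wedge of spheres.\<close>

section \<open>Simplicial complexes and their realizations\<close>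

text \<open>The holes of C are carried by the 4-cycles (0,i), (u,i), (u,i+1), (0,i+1), and a 4-cycle
  is not the boundary of one missing face. Filling the simplex on layer i+1 and (0,i) adds the
  diagonal from (0,i) to (u,i+1): the half of the square at (0,i+1) gets filled, and the other half
  is the triangle T_{u,i}. This filling is legitimate because beforehand the faces on these vertices
  are those of the simplex on layer i+1 and of the edge from (0,i) to (0,i+1), which form a cone
  with apex (0,i+1). The dual reverses inclusions. Since all proper subsets of T_{u,i} already lie
  in C_1, adding the triangles removes only their complements from the dual. Such a complement has
  mn - 3 vertices, whence the dimension mn - 4. For the last step the contraction of D(C') is
  extended over the attached cells by an explicit formula, and the quotient by D(C') is identified
  with the wedge through an explicit quotient map given by stereographic coordinates on each
  cell.\<close>

definition abstract_complex :: "'a set set \<Rightarrow> bool" where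
  "abstract_complex K \<longleftrightarrow> (\<forall>\<rho>\<in>K. finite \<rho> \<and> (\<forall>\<tau>\<subseteq>\<rho>. \<tau> \<in> K))"

abbreviation supp :: "('a \<Rightarrow> real) \<Rightarrow> 'a set" where
  "supp x \<equiv> {v. x v \<noteq> 0}"

lemma abstract_complexD:
  assumes "abstract_complex K" and "\<rho> \<in> K"
  shows "finite \<rho>" and "\<tau> \<subseteq> \<rho> \<Longrightarrow> \<tau> \<in> K"
  using assms by (auto simp: abstract_complex_def)

section \<open>Points and topology of a realization\<close>

lemma topspace_realization:
  "topspace (geometric_realization K) =
     {x. (\<forall>v. 0 \<le> x v) \<and> supp x \<in> K \<and> (\<Sum>v\<in>supp x. x v) = 1}"
  by (simp add: geometric_realization_def)

lemma sum_supp_superset: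
  assumes "finite \<rho>" and "supp x \<subseteq> \<rho>"
  shows "(\<Sum>v\<in>supp x. x v) = (\<Sum>v\<in>\<rho>. x v)"
  using assms by (intro sum.mono_neutral_left) auto

lemma realizationI:
  assumes "abstract_complex K" and "\<rho> \<in> K" and "supp x \<subseteq> \<rho>"
    and "\<And>v. 0 \<le> x v" and "(\<Sum>v\<in>\<rho>. x v) = 1"
  shows "x \<in> topspace (geometric_realization K)"
  using assms abstract_complexD[OF assms(1,2)] sum_supp_superset[of \<rho> x]
  by (auto simp: topspace_realization)

lemma realizationD:
  assumes "x \<in> topspace (geometric_realization K)"
  shows "0 \<le> x v" and "supp x \<in> K"
    and "finite \<rho> \<Longrightarrow> supp x \<subseteq> \<rho> \<Longrightarrow> (\<Sum>v\<in>\<rho>. x v) = 1"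
  using assms sum_supp_superset[of \<rho> x] by (auto simp: topspace_realization)

lemma realization_mono: "K \<subseteq> L \<Longrightarrow>
    topspace (geometric_realization K) \<subseteq> topspace (geometric_realization L)"
  by (auto simp: topspace_realization)

lemma realization_subcomplex:
  assumes "K \<subseteq> L"
  shows "geometric_realization K =
    subtopology (geometric_realization L) (topspace (geometric_realization K))"
proof -
  have "geometric_realization K = subtopology (geometric_realization L)
      {x. (\<forall>v. 0 \<le> x v) \<and> supp x \<in> K \<and> (\<Sum>v\<in>supp x. x v) = 1}"
    unfolding geometric_realization_def subtopology_subtopology using assms
    by (intro arg_cong[where f = "subtopology _"]) auto
  then show ?thesis unfolding topspace_realization .
qed

lemma continuous_map_coordinate:
  "continuous_map (geometric_realization K) euclideanreal (\<lambda>x. x v)"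
  unfolding geometric_realization_def
  by (intro continuous_map_from_subtopology continuous_map_product_projection) simp

lemma continuous_map_into_realization:
  "continuous_map X (geometric_realization K) f \<longleftrightarrow>
     (\<forall>v. continuous_map X euclideanreal (\<lambda>x. f x v)) \<and>
     f \<in> topspace X \<rightarrow> topspace (geometric_realization K)"
  by (simp add: geometric_realization_def continuous_map_in_subtopology
      continuous_map_componentwise_UNIV image_subset_iff_funcset)

text \<open>Since \<open>x\<close> and \<open>f x\<close> lie in a common closed simplex, the
  segment between them stays in that simplex. Continuity is checked one coordinate at a
  time.\<close>

lemma straight_line_homotopy:
  assumes K: "abstract_complex K"
    and f: "continuous_map (geometric_realization K) (geometric_realization K) f"
    and contiguous: "\<And>x. x \<in> topspace (geometric_realization K) \<Longrightarrow> supp x \<union> supp (f x) \<in> K"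
  shows "homotopic_with (\<lambda>_. True) (geometric_realization K) (geometric_realization K) id f"
proof -
  let ?X = "geometric_realization K"
  let ?P = "prod_topology (top_of_set {0..1::real}) ?X"
  define h where "h = (\<lambda>(t::real, x) v. (1 - t) * x v + t * f x v)"
  have t: "continuous_map ?P euclideanreal fst"
    using continuous_map_fst[of "top_of_set {0..1::real}" ?X] continuous_map_in_subtopology by blast
  have x: "continuous_map ?P euclideanreal (\<lambda>p. snd p v)" for v
    using continuous_map_compose[OF continuous_map_snd continuous_map_coordinate]
    by (simp add: o_def)
  have fx: "continuous_map ?P euclideanreal (\<lambda>p. f (snd p) v)" for v
    using continuous_map_compose[OF continuous_map_compose[OF continuous_map_snd f]
        continuous_map_coordinate]
    by (simp add: o_def)
  have "continuous_map ?P euclideanreal (\<lambda>p. h p v)" for v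
    unfolding h_def case_prod_beta by (intro continuous_map_add continuous_map_diff continuous_map_real_mult t x fx) simp
  moreover have "h (t, x) \<in> topspace ?X" if t: "t \<in> {0..1}" and x: "x \<in> topspace ?X" for t x
  proof -
    let ?\<rho> = "supp x \<union> supp (f x)"
    have fx: "f x \<in> topspace ?X"
      using continuous_map_funspace[OF f] x by (rule funcset_mem)
    have \<rho>: "?\<rho> \<in> K" using contiguous[OF x] .
    then have fin: "finite ?\<rho>" by (rule abstract_complexD(1)[OF K])
    show ?thesis
    proof (rule realizationI[OF K \<rho>])
      show "supp (h (t, x)) \<subseteq> ?\<rho>" by (auto simp: h_def)
      show "0 \<le> h (t, x) v" for v
        using t realizationD(1)[OF x] realizationD(1)[OF fx] by (simp add: h_def)
      show "(\<Sum>v\<in>?\<rho>. h (t, x) v) = 1"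
        using realizationD(3)[OF x fin] realizationD(3)[OF fx fin]
        by (simp only: h_def prod.case sum.distrib sum_distrib_left[symmetric]) simp
    qed
  qed
  ultimately have "continuous_map ?P ?X h"
    by (auto simp: continuous_map_into_realization)
  then show ?thesis
    unfolding homotopic_with_def by (intro exI[of _ h]) (auto simp: h_def)
qed

text \<open>The constant map to the apex satisfies the hypothesis of
  \<open>straight_line_homotopy\<close>: the two supports together form
  \<open>insert v (supp x)\<close>.\<close>

lemma contractible_realization_cone:
  assumes K: "abstract_complex K" and v: "{v} \<in> K" and cone: "\<And>\<rho>. \<rho> \<in> K \<Longrightarrow> insert v \<rho> \<in> K"
  shows "contractible_space (geometric_realization K)"
proof -
  let ?e = "\<lambda>u. if u = v then 1 else 0 :: real"
  have supp: "supp ?e = {v}" by auto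
  have "?e \<in> topspace (geometric_realization K)"
    by (rule realizationI[OF K v]) auto
  then have "homotopic_with (\<lambda>_. True) (geometric_realization K) (geometric_realization K) id (\<lambda>_. ?e)"
    using cone by (intro straight_line_homotopy[OF K]) (auto simp: supp dest: realizationD(2))
  then show ?thesis
    unfolding contractible_space_def by blast
qed

lemma Min_image_attained:
  assumes "finite S" and "S \<noteq> {}"
  shows "\<exists>v\<in>S. x v = Min (x ` S)"
proof -
  have "Min (x ` S) \<in> x ` S" using assms by (intro Min_in) auto
  then show ?thesis by (rule imageE) (metis)
qed

lemma continuous_map_Min:
  fixes f :: "'b \<Rightarrow> 'a \<Rightarrow> real"
  assumes "finite I" and "I \<noteq> {}" and "\<And>i. i \<in> I \<Longrightarrow> continuous_map X euclideanreal (f i)"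
  shows "continuous_map X euclideanreal (\<lambda>x. Min ((\<lambda>i. f i x) ` I))"
  using assms
  by (induction I rule: finite_ne_induct) (simp_all add: continuous_map_real_min)

text \<open>The deformation moves the weight $\min_\sigma x$ from each vertex of $\sigma$ to $v$.\<close>

lemma collapse:
  assumes K: "abstract_complex K" and \<sigma>: "finite \<sigma>" "\<sigma> \<noteq> {}" and v: "v \<notin> \<sigma>"
    and cone: "\<And>\<rho>. \<rho> \<in> K \<Longrightarrow> \<sigma> \<subseteq> \<rho> \<Longrightarrow> insert v \<rho> \<in> K"
  shows "geometric_realization K homotopy_equivalent_space
         geometric_realization {\<rho> \<in> K. \<not> \<sigma> \<subseteq> \<rho>}"
proof -
  let ?L = "{\<rho> \<in> K. \<not> \<sigma> \<subseteq> \<rho>}"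
  let ?X = "geometric_realization K" and ?Y = "geometric_realization ?L"
  have L: "abstract_complex ?L"
    using K unfolding abstract_complex_def by blast
  define \<mu> where "\<mu> = (\<lambda>x::'a \<Rightarrow> real. Min (x ` \<sigma>))"
  \<comment> \<open>The weight \<open>card \<sigma>\<close> at \<open>v\<close> compensates the loss
    of one minimum at each vertex of \<open>\<sigma>\<close>, so the total stays 1. A vertex where
    the minimum is attained drops to 0, so the new support no longer contains
    \<open>\<sigma>\<close>.\<close>
  define r where "r = (\<lambda>x u. x u + \<mu> x * (if u = v then real (card \<sigma>) else if u \<in> \<sigma> then - 1 else 0))"
  have \<mu>_le: "\<mu> x \<le> x u" if "u \<in> \<sigma>" for x u
    using that \<sigma> by (simp add: \<mu>_def)
  have \<mu>_attained: "\<exists>u\<in>\<sigma>. x u = \<mu> x" for x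
    unfolding \<mu>_def using \<sigma> by (rule Min_image_attained)
  have \<mu>_nonneg: "0 \<le> \<mu> x" if "x \<in> topspace ?X" for x
    using \<mu>_attained[of x] realizationD(1)[OF that] by metis
  have r_in: "r x \<in> topspace ?Y \<and> supp x \<union> supp (r x) \<in> K" if x: "x \<in> topspace ?X" for x
  proof (cases "\<mu> x = 0")
    case True
    then have "r x = x" by (simp add: r_def)
    moreover have "\<not> \<sigma> \<subseteq> supp x" using \<mu>_attained[of x] True by auto
    ultimately show ?thesis
      using x by (auto simp: topspace_realization)
  next
    case False
    with \<mu>_nonneg[OF x] have pos: "0 < \<mu> x" by simp
    have \<sigma>x: "\<sigma> \<subseteq> supp x" using \<mu>_le[of _ x] pos by fastforce
    let ?\<rho> = "insert v (supp x)"
    have \<rho>: "?\<rho> \<in> K" using cone[OF realizationD(2)[OF x] \<sigma>x] .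
    have fin: "finite ?\<rho>" by (rule abstract_complexD(1)[OF K \<rho>])
    have sub: "supp (r x) \<subseteq> ?\<rho>" using \<sigma>x by (auto simp: r_def)
    have eq: "(\<Sum>u\<in>?\<rho>. if u = v then real (card \<sigma>) else if u \<in> \<sigma> then - 1 else 0) = 0"
    proof -
      have "(\<Sum>u\<in>?\<rho>. if u = v then real (card \<sigma>) else if u \<in> \<sigma> then - 1 else 0)
          = (\<Sum>u\<in>insert v \<sigma>. if u = v then real (card \<sigma>) else if u \<in> \<sigma> then - 1 else 0)"
        using fin \<sigma>x by (intro sum.mono_neutral_right) auto
      also have "\<dots> = real (card \<sigma>) + (\<Sum>u\<in>\<sigma>. if u = v then real (card \<sigma>) else if u \<in> \<sigma> then - 1 else 0)"
        using \<sigma> v by (subst sum.insert) auto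
      also have "(\<Sum>u\<in>\<sigma>. if u = v then real (card \<sigma>) else if u \<in> \<sigma> then - 1 else 0) = (\<Sum>u\<in>\<sigma>. - 1)"
        using v by (intro sum.cong) auto
      finally show ?thesis by simp
    qed
    have "r x \<in> topspace ?X"
    proof (rule realizationI[OF K \<rho> sub])
      show "0 \<le> r x u" for u
        using realizationD(1)[OF x, of u] \<mu>_le[of u x] pos by (auto simp: r_def)
      show "(\<Sum>u\<in>?\<rho>. r x u) = 1"
        using realizationD(3)[OF x fin] eq
        by (simp only: r_def sum.distrib sum_distrib_left[symmetric] subset_insertI)
    qed
    moreover have "\<not> \<sigma> \<subseteq> supp (r x)"
      using \<mu>_attained[of x] v by (auto simp: r_def)
    moreover have "supp x \<union> supp (r x) \<in> K"
      using sub by (intro abstract_complexD(2)[OF K \<rho>]) auto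
    ultimately show ?thesis
      by (auto simp: topspace_realization)
  qed
  have "continuous_map ?X euclideanreal \<mu>"
    unfolding \<mu>_def using continuous_map_Min[OF \<sigma>, of ?X "\<lambda>u x. x u"]
    by (simp add: continuous_map_coordinate)
  then have "continuous_map ?X euclideanreal (\<lambda>x. r x u)" for u
    unfolding r_def by (intro continuous_map_add continuous_map_real_mult continuous_map_coordinate) simp_all
  then have r: "continuous_map ?X ?Y r"
    using r_in by (auto simp: continuous_map_into_realization)
  have incl: "continuous_map ?Y ?X id"
    using realization_mono[of ?L K]
    by (auto simp: continuous_map_into_realization continuous_map_coordinate)
  have "continuous_map ?X ?X r"
    using continuous_map_compose[OF r incl] by simp
  then have "homotopic_with (\<lambda>_. True) ?X ?X id r"
    using r_in by (intro straight_line_homotopy[OF K]) auto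
  moreover have "r x = x" if "x \<in> topspace ?Y" for x
  proof -
    have "\<not> \<sigma> \<subseteq> supp x" using realizationD(2)[OF that] by simp
    then obtain u where "u \<in> \<sigma>" "x u = 0" by auto
    moreover have "0 \<le> \<mu> x"
      using \<mu>_nonneg that realization_mono[of ?L K] by blast
    ultimately have "\<mu> x = 0" using \<mu>_le[of u x] by simp
    then show ?thesis by (simp add: r_def)
  qed
  ultimately show ?thesis
    using r incl
    by (intro deformation_retract_imp_homotopy_equivalent_space[of _ r])
      (auto simp: retraction_maps_def homotopic_with_symD)
qed

section \<open>Collapsing a contractible subcomplex\<close>

text \<open>The end map of \<open>\<Phi>\<close> is constant on \<open>A\<close>, hence factors
  through \<open>f\<close> as a map \<open>g\<close> from \<open>W\<close> to \<open>X\<close>. Thus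
  \<open>\<Phi>\<close> itself joins the identity to \<open>g \<circ> f\<close>. As every stage maps
  \<open>A\<close> into \<open>A\<close>, \<open>\<Phi>\<close> also descends to a homotopy
  \<open>G\<close> on \<open>W\<close> from the identity to \<open>f \<circ> g\<close>.\<close>

lemma homotopy_equivalent_quotient:
  assumes f: "quotient_map X W f"
    and fibres: "\<And>x y. x \<in> topspace X \<Longrightarrow> y \<in> topspace X \<Longrightarrow>
                   f x = f y \<longleftrightarrow> x = y \<or> x \<in> A \<and> y \<in> A"
    and \<Phi>: "continuous_map (prod_topology (top_of_set {0..1::real}) X) X \<Phi>"
    and \<Phi>_0: "\<And>x. x \<in> topspace X \<Longrightarrow> \<Phi> (0, x) = x"
    and \<Phi>_A: "\<And>t x. t \<in> {0..1} \<Longrightarrow> x \<in> A \<Longrightarrow> \<Phi> (t, x) \<in> A"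
    and \<Phi>_1: "\<And>x. x \<in> A \<Longrightarrow> \<Phi> (1, x) = a"
  shows "X homotopy_equivalent_space W"
proof -
  let ?I = "top_of_set {0..1::real}"
  have \<Phi>_in: "\<Phi> (t, x) \<in> topspace X" if "t \<in> {0..1}" "x \<in> topspace X" for t x
    using continuous_map_funspace[OF \<Phi>] that by auto
  have surj: "f ` topspace X = topspace W"
    using f by (simp add: quotient_map_def)
  have cf: "continuous_map X W f"
    using f by (rule quotient_imp_continuous_map)
  have "continuous_map X (prod_topology ?I X) (\<lambda>x. (1, x))"
    by (auto simp: continuous_map_pairwise o_def)
  from continuous_map_compose[OF this \<Phi>]
  have \<Phi>1: "continuous_map X X (\<lambda>x. \<Phi> (1, x))" by (simp add: o_def)
  obtain g where g: "continuous_map W X g"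
    and g_f: "\<And>x. x \<in> topspace X \<Longrightarrow> g (f x) = \<Phi> (1, x)"
    using quotient_map_lift_exists[OF f \<Phi>1] fibres \<Phi>_1 by (metis (no_types, lifting))
  \<comment> \<open>A product of a quotient map with a locally compact Hausdorff space is again a
    quotient map; this is what makes the descended homotopy jointly continuous in time and
    point.\<close>
  have q: "quotient_map (prod_topology ?I X) (prod_topology ?I W) (\<lambda>(t, x). (t, f x))"
    by (rule quotient_map_prod_right[OF _ _ f])
      (auto intro!: compact_imp_locally_compact_space Hausdorff_space_subtopology
        simp: compact_space_subtopology compactin_euclidean_iff)
  have f\<Phi>: "continuous_map (prod_topology ?I X) W (\<lambda>p. f (\<Phi> p))"
    using continuous_map_compose[OF \<Phi> cf] by (simp add: o_def)
  have compat: "f (\<Phi> p) = f (\<Phi> p')"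
    if "p \<in> topspace (prod_topology ?I X)" "p' \<in> topspace (prod_topology ?I X)"
      and eq: "(case p of (t, x) \<Rightarrow> (t, f x)) = (case p' of (t, x) \<Rightarrow> (t, f x))" for p p'
  proof -
    obtain t x t' x' where [simp]: "p = (t, x)" "p' = (t', x')" by fastforce
    have t: "t \<in> {0..1}" "t' = t" and x: "x \<in> topspace X" "x' \<in> topspace X" "f x = f x'"
      using that by auto
    show ?thesis
      using fibres[OF x(1,2)] fibres[OF \<Phi>_in[OF t(1) x(1)] \<Phi>_in[OF t(1) x(2)]]
        \<Phi>_A[OF t(1)] x(3) t(2) by auto
  qed
  obtain G
    where G: "continuous_map (prod_topology ?I W) W G"
      and G_f: "\<And>p. p \<in> topspace (prod_topology ?I X) \<Longrightarrow> G (case p of (t, x) \<Rightarrow> (t, f x)) = f (\<Phi> p)"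
  proof (rule quotient_map_lift_exists[OF q f\<Phi>], goal_cases)
    case (1 p p')
    show ?case by (rule compat[OF 1(2-4)])
  next
    case (2 G)
    show ?case by (rule 2(1)[OF 2(2,4)])
  qed
  have G_f: "G (t, f x) = f (\<Phi> (t, x))" if "t \<in> {0..1}" "x \<in> topspace X" for t x
    using G_f[of "(t, x)"] that by simp
  have gf: "homotopic_with (\<lambda>_. True) X X id (g \<circ> f)"
  proof (subst homotopic_with, simp, intro exI[of _ \<Phi>] conjI ballI)
    fix x assume "x \<in> topspace X"
    then show "\<Phi> (0, x) = id x" "\<Phi> (1, x) = (g \<circ> f) x"
      by (simp_all add: \<Phi>_0 g_f)
  qed (simp_all add: \<Phi>)
  have fg: "homotopic_with (\<lambda>_. True) W W id (f \<circ> g)"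
  proof (subst homotopic_with, simp, intro exI[of _ G] conjI ballI)
    fix w assume "w \<in> topspace W"
    then obtain x where x: "x \<in> topspace X" "w = f x" using surj by auto
    then show "G (0, w) = id w" "G (1, w) = (f \<circ> g) w"
      by (simp_all add: G_f \<Phi>_0 g_f)
  qed (simp_all add: G)
  show ?thesis
    unfolding homotopy_equivalent_space_def
    by (intro exI[of _ f] exI[of _ g] conjI cf g homotopic_with_symD[OF gf] homotopic_with_symD[OF fg])
qed

text \<open>The radial coordinate \<open>s\<close> of a cell is \<open>0\<close> at the barycentre and \<open>1\<close> on the boundary. At time
  \<open>t\<close> the concentric cell \<open>s \<le> 1 / (1 + t)\<close> is stretched over the whole cell, and the collar outside
  of it follows the contraction of \<open>L\<close>.\<close>

lemma extend_contraction:
  fixes R :: "nat \<Rightarrow> 'a set"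
  assumes L: "abstract_complex L" and K: "K = L \<union> R ` {..<k}"
    and card: "\<And>i. i < k \<Longrightarrow> card (R i) = Suc d" and inj: "inj_on R {..<k}"
    and notin: "\<And>i. i < k \<Longrightarrow> R i \<notin> L" and boundary: "\<And>i \<tau>. i < k \<Longrightarrow> \<tau> \<subset> R i \<Longrightarrow> \<tau> \<in> L"
    and contr: "contractible_space (geometric_realization L)"
  obtains \<Phi> a where
    "continuous_map (prod_topology (top_of_set {0..1::real}) (geometric_realization K))
       (geometric_realization K) \<Phi>"
    "\<And>x. x \<in> topspace (geometric_realization K) \<Longrightarrow> \<Phi> (0, x) = x"
    "\<And>t x. t \<in> {0..1} \<Longrightarrow> x \<in> topspace (geometric_realization L) \<Longrightarrow>
       \<Phi> (t, x) \<in> topspace (geometric_realization L)"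
    "\<And>x. x \<in> topspace (geometric_realization L) \<Longrightarrow> \<Phi> (1, x) = a"
proof -
  let ?X = "geometric_realization K" and ?Y = "geometric_realization L"
  let ?I = "top_of_set {0..1::real}"
  let ?P = "prod_topology ?I ?X"
  obtain H a where H: "continuous_map (prod_topology ?I ?Y) ?Y H"
    and H_0: "\<And>x. H (0, x) = x" and H_1: "\<And>x. H (1, x) = a"
    using contr unfolding contractible_space_def homotopic_with_def by auto
  have finR: "finite (R i)" and neR: "R i \<noteq> {}" if "i < k" for i
    using card[OF that] by (auto intro: card_ge_0_finite)
  have absK: "abstract_complex K"
    unfolding abstract_complex_def
  proof (intro ballI conjI allI impI)
    fix \<rho> assume "\<rho> \<in> K"
    then have \<rho>: "\<rho> \<in> L \<or> (\<exists>i<k. \<rho> = R i)" unfolding K by auto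
    then show "finite \<rho>" using abstract_complexD(1)[OF L] finR by auto
    fix \<tau> assume "\<tau> \<subseteq> \<rho>"
    then have "\<tau> = \<rho> \<or> \<tau> \<subset> \<rho>" by blast
    with \<rho> \<open>\<rho> \<in> K\<close> have "\<tau> \<in> L \<or> \<tau> \<in> K"
      using abstract_complexD(2)[OF L] boundary by auto
    then show "\<tau> \<in> K" unfolding K by auto
  qed
  define \<mu> where "\<mu> = (\<lambda>i (x :: 'a \<Rightarrow> real). Min (x ` R i))"
  \<comment> \<open>On the cell \<open>R i\<close>, \<open>M x\<close> is the constant vector \<mu>
    i x, that is, 1 - s times the barycentre. The other cells contribute 0, so the sums over all
    cells give formulas valid on the whole realization, and their continuity is immediate.\<close>
  define M where "M = (\<lambda>x v. \<Sum>i<k. if v \<in> R i then \<mu> i x else 0)"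
  define s where "s = (\<lambda>x. 1 - real (Suc d) * (\<Sum>i<k. \<mu> i x))"
  have \<mu>_le: "\<mu> i x \<le> x v" if "i < k" "v \<in> R i" for i x v
    using that finR by (simp add: \<mu>_def)
  have \<mu>_attained: "\<exists>v\<in>R i. x v = \<mu> i x" if "i < k" for i x
    unfolding \<mu>_def using finR[OF that] neR[OF that] by (rule Min_image_attained)
  have \<mu>_zero: "\<mu> i x = 0" if x: "x \<in> topspace ?X" and i: "i < k" and R: "\<not> R i \<subseteq> supp x" for i x
  proof -
    obtain v where "v \<in> R i" "x v = 0" using R by auto
    moreover have "0 \<le> \<mu> i x"
      using \<mu>_attained[OF i, of x] realizationD(1)[OF x] by metis
    ultimately show ?thesis using \<mu>_le[OF i, of v x] by simp
  qed
  have on_L: "M x = (\<lambda>_. 0)" "s x = 1" if x: "x \<in> topspace ?X" and sx: "supp x \<in> L" for x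
  proof -
    have "\<mu> i x = 0" if "i < k" for i
      using \<mu>_zero[OF x that] notin[OF that] abstract_complexD(2)[OF L sx] by blast
    then show "M x = (\<lambda>_. 0)" "s x = 1"
      by (auto simp: M_def s_def intro!: ext sum.neutral)
  qed
  have on_R: "M x = (\<lambda>v. if v \<in> R i then \<mu> i x else 0)" "s x = 1 - real (Suc d) * \<mu> i x"
    if x: "x \<in> topspace ?X" and i: "i < k" and sx: "supp x \<subseteq> R i" for x i
  proof -
    \<comment> \<open>Distinct cells have equally many vertices, so none contains another. Hence a
      point supported in \<open>R i\<close> has a zero coordinate in every other cell.\<close>
    have zero: "\<mu> j x = 0" if j: "j \<in> {..<k} - {i}" for j
    proof (rule \<mu>_zero[OF x])
      have "R j \<noteq> R i" using inj i j by (auto dest: inj_onD)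
      then have "\<not> R j \<subseteq> R i"
        using card_subset_eq[OF finR[OF i], of "R j"] card i j by auto
      then show "\<not> R j \<subseteq> supp x" using sx by blast
    qed (use j in auto)
    have "(\<Sum>j<k. \<mu> j x) = \<mu> i x"
      using i zero by (subst sum.remove[of _ i]) auto
    then show "s x = 1 - real (Suc d) * \<mu> i x" by (simp add: s_def)
    show "M x = (\<lambda>v. if v \<in> R i then \<mu> i x else 0)"
    proof
      fix v
      have "M x v = (\<Sum>j\<in>{i}. if v \<in> R j then \<mu> j x else 0)"
        unfolding M_def using i zero by (intro sum.mono_neutral_right) auto
      then show "M x v = (if v \<in> R i then \<mu> i x else 0)" by simp
    qed
  qed
  have cases_K: "supp x \<in> L \<or> (\<exists>i<k. supp x = R i)" if "x \<in> topspace ?X" for x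
    using realizationD(2)[OF that] K by auto
  have s_bounds: "0 \<le> s x" "s x \<le> 1" if x: "x \<in> topspace ?X" for x
  proof -
    have "0 \<le> s x \<and> s x \<le> 1"
    proof (cases "supp x \<in> L")
      case True
      then show ?thesis using on_L[OF x] by simp
    next
      case False
      then obtain i where i: "i < k" "supp x = R i" using cases_K[OF x] by blast
      have "real (Suc d) * \<mu> i x = (\<Sum>v\<in>R i. \<mu> i x)" using card[OF i(1)] by simp
      also have "\<dots> \<le> (\<Sum>v\<in>R i. x v)" by (intro sum_mono \<mu>_le[OF i(1)])
      also have "\<dots> = 1" using realizationD(3)[OF x finR[OF i(1)]] i(2) by simp
      finally have "real (Suc d) * \<mu> i x \<le> 1" .
      moreover have "0 \<le> \<mu> i x"
        using \<mu>_attained[OF i(1), of x] realizationD(1)[OF x] by metis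
      ultimately show ?thesis using on_R(2)[OF x i(1)] i(2) by simp
    qed
    then show "0 \<le> s x" "s x \<le> 1" by auto
  qed
  \<comment> \<open>Radial projection from the barycentre: a point x of a cell is (1 - s) times the
    barycentre plus s times its projection. Subtracting the least coordinate puts the point on the
    boundary up to scale, and the remaining mass is s. On \<open>L\<close> the projection is the
    identity.\<close>
  have proj: "(\<lambda>v. (x v - M x v) / s x) \<in> topspace ?Y" if x: "x \<in> topspace ?X" and s: "s x \<noteq> 0" for x
  proof (cases "supp x \<in> L")
    case True
    then show ?thesis using on_L[OF x] x by (simp add: topspace_realization)
  next
    case False
    then obtain i where i: "i < k" "supp x = R i" using cases_K[OF x] by blast
    let ?y = "\<lambda>v. (x v - M x v) / s x"
    note M = on_R[OF x i(1) equalityD1[OF i(2)]]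
    obtain u where u: "u \<in> R i" "x u = \<mu> i x" using \<mu>_attained[OF i(1)] by metis
    have sub: "supp ?y \<subseteq> R i - {u}" using i(2) u by (auto simp: M(1))
    have "(\<Sum>v\<in>R i. ?y v) = ((\<Sum>v\<in>R i. x v) - real (Suc d) * \<mu> i x) / s x"
      using card[OF i(1)] by (simp add: M(1) sum_subtractf flip: sum_divide_distrib)
    also have "(\<Sum>v\<in>R i. x v) = 1"
      using realizationD(3)[OF x finR[OF i(1)]] i(2) by simp
    finally have sum: "(\<Sum>v\<in>R i. ?y v) = 1" using s M(2) by simp
    show ?thesis
    proof (rule realizationI[OF L _ sub])
      show "R i - {u} \<in> L" by (rule boundary[OF i(1)]) (use u(1) in auto)
      show "0 \<le> ?y v" for v
      proof -
        have "M x v \<le> x v"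
          using \<mu>_le[OF i(1), of v x] realizationD(1)[OF x, of v] unfolding M(1) by auto
        then show ?thesis using s_bounds(1)[OF x] by simp
      qed
      have "?y u = 0" using u by (simp add: M(1))
      then show "(\<Sum>v\<in>R i - {u}. ?y v) = 1"
        using sum sum.remove[OF finR[OF i(1)] u(1), of ?y] by linarith
    qed
  qed
  \<comment> \<open>\<open>B\<close> is the collar, including all of \<open>L\<close> at all times.
    \<open>A i\<close> is the part of the closed cell that is being stretched. They meet where s (1
    + t) = 1.\<close>
  define B where "B = {p \<in> topspace ?P. 1 \<le> s (snd p) * (1 + fst p)}"
  define A where "A = (\<lambda>i. {p \<in> topspace ?P. supp (snd p) \<subseteq> R i \<and> s (snd p) * (1 + fst p) \<le> 1})"
  \<comment> \<open>A collar point is projected to \<open>L\<close> and follows the contraction for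
    time s (1 + t) - 1. This time is 0 on the interface with the inner cell, and is t on
    \<open>L\<close>, where s = 1.\<close>
  define \<psi> where "\<psi> = (\<lambda>p. H (s (snd p) * (1 + fst p) - 1, \<lambda>v. (snd p v - M (snd p) v) / s (snd p)))"
  \<comment> \<open>The radial coordinate s is multiplied by 1 + t and the projection y is kept: the
    value is 1 - s (1 + t) times the barycentre plus s (1 + t) y. Writing s y as x - M x avoids a
    division at the barycentre.\<close>
  define \<phi> where "\<phi> = (\<lambda>i p v. (if v \<in> R i then (1 - s (snd p) * (1 + fst p)) / real (Suc d) else 0)
      + (1 + fst p) * (snd p v - M (snd p) v))"
  have ct: "continuous_map ?P euclideanreal fst"
    using continuous_map_fst[of ?I ?X] continuous_map_in_subtopology by blast
  have cx: "continuous_map ?P euclideanreal (\<lambda>p. snd p v)" for v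
    using continuous_map_compose[OF continuous_map_snd continuous_map_coordinate]
    by (simp add: o_def)
  have c\<mu>: "continuous_map ?P euclideanreal (\<lambda>p. \<mu> i (snd p))" if "i < k" for i
    unfolding \<mu>_def using continuous_map_Min[OF finR neR, OF that that, of ?P "\<lambda>v p. snd p v"]
    by (simp add: cx)
  have cM: "continuous_map ?P euclideanreal (\<lambda>p. M (snd p) v)" for v
    unfolding M_def by (intro continuous_map_sum) (auto simp: c\<mu>)
  have cs: "continuous_map ?P euclideanreal (\<lambda>p. s (snd p))"
    unfolding s_def
    by (intro continuous_map_diff continuous_map_real_mult continuous_map_sum) (auto simp: c\<mu>)
  have cst: "continuous_map ?P euclideanreal (\<lambda>p. s (snd p) * (1 + fst p))"
    by (intro continuous_map_add continuous_map_real_mult ct cs) simp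
  have closedB: "closedin ?P B"
    using closedin_continuous_map_preimage[OF cst, of "{1..}"] by (simp add: B_def)
  have closedA: "closedin ?P (A i)" for i
  proof -
    have "closedin ?P {p \<in> topspace ?P. s (snd p) * (1 + fst p) \<in> {..1}}"
      by (rule closedin_continuous_map_preimage[OF cst]) simp
    moreover have "closedin ?P {p \<in> topspace ?P. snd p v \<in> {0}}" for v
      by (rule closedin_continuous_map_preimage[OF cx]) simp
    ultimately have "closedin ?P (\<Inter>(insert {p \<in> topspace ?P. s (snd p) * (1 + fst p) \<in> {..1}}
        ((\<lambda>v. {p \<in> topspace ?P. snd p v \<in> {0}}) ` (- R i))))"
      by (intro closedin_Inter) auto
    also have "\<Inter>(insert {p \<in> topspace ?P. s (snd p) * (1 + fst p) \<in> {..1}}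
        ((\<lambda>v. {p \<in> topspace ?P. snd p v \<in> {0}}) ` (- R i))) = A i"
      by (auto simp: A_def)
    finally show ?thesis .
  qed
  have B_s: "s (snd p) \<noteq> 0" "s (snd p) * (1 + fst p) - 1 \<in> {0..1}" "snd p \<in> topspace ?X"
    if "p \<in> B" for p
  proof -
    have *: "fst p \<in> {0..1}" "1 \<le> s (snd p) * (1 + fst p)" and x: "snd p \<in> topspace ?X"
      using that by (auto simp: B_def)
    have "s (snd p) * (1 + fst p) \<le> 1 * 2"
      using * s_bounds[OF x] by (intro mult_mono) auto
    with * x show "s (snd p) \<noteq> 0" "s (snd p) * (1 + fst p) - 1 \<in> {0..1}" "snd p \<in> topspace ?X"
      by auto
  qed
  have c\<psi>: "continuous_map (subtopology ?P B) ?X \<psi>"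
  proof -
    let ?B = "subtopology ?P B"
    have "continuous_map ?B (prod_topology ?I ?Y)
        (\<lambda>p. (s (snd p) * (1 + fst p) - 1, \<lambda>v. (snd p v - M (snd p) v) / s (snd p)))"
      unfolding continuous_map_pairwise o_def fst_conv snd_conv
    proof
      show "continuous_map ?B ?I (\<lambda>p. s (snd p) * (1 + fst p) - 1)"
        unfolding continuous_map_in_subtopology
        using B_s by (auto intro!: continuous_map_diff continuous_map_from_subtopology[OF cst])
      show "continuous_map ?B ?Y (\<lambda>p v. (snd p v - M (snd p) v) / s (snd p))"
        unfolding continuous_map_into_realization
      proof (intro conjI allI)
        show "continuous_map ?B euclideanreal (\<lambda>p. (snd p v - M (snd p) v) / s (snd p))" for v
          using B_s(1) by (intro continuous_map_real_divide continuous_map_diff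
              continuous_map_from_subtopology[OF cx] continuous_map_from_subtopology[OF cM]
              continuous_map_from_subtopology[OF cs]) auto
        show "(\<lambda>p v. (snd p v - M (snd p) v) / s (snd p)) \<in> topspace ?B \<rightarrow> topspace ?Y"
          using proj B_s(1,3) by auto
      qed
    qed
    from continuous_map_compose[OF this H] have "continuous_map ?B ?Y \<psi>"
      by (simp add: \<psi>_def o_def)
    then show ?thesis
      using realization_subcomplex[of L K] K by (metis Un_upper1 continuous_map_in_subtopology)
  qed
  have c\<phi>: "continuous_map (subtopology ?P (A i)) ?X (\<phi> i)" if i: "i < k" for i
    unfolding continuous_map_into_realization
  proof (intro conjI allI)
    let ?A = "subtopology ?P (A i)"
    have "continuous_map ?P euclideanreal (\<lambda>p. \<phi> i p v)" for v
      unfolding \<phi>_def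
      by (cases "v \<in> R i"; simp only: if_True if_False)
        (intro continuous_map_add continuous_map_real_mult continuous_map_diff
          continuous_map_real_divide cst cx cM ct; simp)+
    then show "continuous_map ?A euclideanreal (\<lambda>p. \<phi> i p v)" for v
      by (rule continuous_map_from_subtopology)
    show "\<phi> i \<in> topspace ?A \<rightarrow> topspace ?X"
    proof
      fix p assume "p \<in> topspace ?A"
      then have p: "fst p \<in> {0..1}" "supp (snd p) \<subseteq> R i" "s (snd p) * (1 + fst p) \<le> 1"
        and x: "snd p \<in> topspace ?X"
        by (auto simp: A_def)
      note M = on_R[OF x i p(2)]
      show "\<phi> i p \<in> topspace ?X"
      proof (rule realizationI[OF absK])
        show "R i \<in> K" using i by (simp add: K)
        show "supp (\<phi> i p) \<subseteq> R i" using p(2) by (auto simp: \<phi>_def M(1))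
        show "0 \<le> \<phi> i p v" for v
          using p realizationD(1)[OF x, of v] \<mu>_le[OF i, of v "snd p"] by (simp add: \<phi>_def M(1))
        have "(\<Sum>v\<in>R i. \<phi> i p v) = (1 - s (snd p) * (1 + fst p))
            + (1 + fst p) * ((\<Sum>v\<in>R i. snd p v) - real (Suc d) * \<mu> i (snd p))"
          using card[OF i] by (simp add: \<phi>_def M(1) sum.distrib sum_subtractf flip: sum_distrib_left)
        also have "(\<Sum>v\<in>R i. snd p v) = 1"
          by (rule realizationD(3)[OF x finR[OF i] p(2)])
        finally show "(\<Sum>v\<in>R i. \<phi> i p v) = 1"
          using M(2) by (simp add: algebra_simps)
      qed
    qed
  qed
  define T where "T = case_option B A"
  define F where "F = case_option \<psi> \<phi>"
  let ?J = "insert None (Some ` {..<k})"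
  \<comment> \<open>On the interface the contraction has run for time 0 and the stretched point has
    reached the boundary, so both formulas give the projection.\<close>
  have agree_B: "\<psi> p = \<phi> i p" if i: "i < k" and p: "p \<in> B \<inter> A i" for i p
  proof -
    have eq: "s (snd p) * (1 + fst p) = 1" using p by (auto simp: A_def B_def)
    then have "1 + fst p = 1 / s (snd p)" using B_s(1)[of p] p by (simp add: field_simps)
    then show ?thesis using eq by (auto simp: \<psi>_def \<phi>_def H_0)
  qed
  \<comment> \<open>Two different closed cells meet only inside \<open>L\<close>. There s = 1, so s
    (1 + t) \<le> 1 forces t = 0, and both formulas return the point itself.\<close>
  have agree_A: "\<phi> i p = \<phi> j p" if i: "i < k" and j: "j < k" and p: "p \<in> A i \<inter> A j" for i j p
  proof (cases "i = j")
    case False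
    have x: "snd p \<in> topspace ?X" and t: "fst p \<in> {0..1}" "s (snd p) * (1 + fst p) \<le> 1"
      and sub: "supp (snd p) \<subseteq> R i" "supp (snd p) \<subseteq> R j"
      using p by (auto simp: A_def)
    have "supp (snd p) \<noteq> R i"
    proof
      assume "supp (snd p) = R i"
      then have "R i \<subseteq> R j" using sub by simp
      then have "R i = R j" using card_subset_eq[OF finR[OF j]] card i j by auto
      then show False using inj i j False by (auto dest: inj_onD)
    qed
    then have "supp (snd p) \<in> L" using boundary[OF i] sub(1) by blast
    note on_L[OF x this]
    moreover from this have "fst p = 0" using t by simp
    ultimately show ?thesis by (auto simp: \<phi>_def)
  qed simp
  obtain \<Phi> where \<Phi>: "continuous_map ?P ?X \<Phi>"
    and \<Phi>_eq: "\<And>p j. j \<in> ?J \<Longrightarrow> p \<in> topspace ?P \<inter> T j \<Longrightarrow> \<Phi> p = F j p"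
  proof (rule pasting_lemma_exists_closed[of ?J ?P T ?X F])
    show "topspace ?P \<subseteq> \<Union> (T ` ?J)"
    proof
      fix p assume p: "p \<in> topspace ?P"
      then have x: "snd p \<in> topspace ?X" and t: "fst p \<in> {0..1}" by auto
      show "p \<in> \<Union> (T ` ?J)"
      proof (cases "1 \<le> s (snd p) * (1 + fst p)")
        case True
        then show ?thesis using p by (simp add: T_def B_def)
      next
        case False
        then have "supp (snd p) \<notin> L" using on_L(2)[OF x] t by auto
        then obtain i where "i < k" "supp (snd p) = R i" using cases_K[OF x] by blast
        then have "p \<in> T (Some i)" using p False by (simp add: T_def A_def)
        then show ?thesis using \<open>i < k\<close> by blast
      qed
    qed
  next
    fix i assume "i \<in> ?J"
    then show "closedin ?P (T i)" "continuous_map (subtopology ?P (T i)) ?X (F i)"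
      using closedB closedA c\<psi> c\<phi> by (auto simp: T_def F_def)
  next
    fix i j p assume "i \<in> ?J" "j \<in> ?J" "p \<in> topspace ?P \<inter> T i \<inter> T j"
    then show "F i p = F j p"
      using agree_A[of "the i" "the j" p] agree_B[of "the i" p] agree_B[of "the j" p]
      by (cases i; cases j) (auto simp: T_def F_def)
  qed auto
  have at_L: "\<Phi> (t, x) = H (t, x)" if t: "t \<in> {0..1}" and x: "x \<in> topspace ?Y" for t x
  proof -
    have x': "x \<in> topspace ?X" and sx: "supp x \<in> L"
      using x realization_mono[of L K] realizationD(2)[OF x] by (auto simp: K)
    note on_L = on_L[OF x' sx]
    have "(t, x) \<in> B" using t x' on_L by (simp add: B_def)
    then have "\<Phi> (t, x) = \<psi> (t, x)" using \<Phi>_eq[of None "(t, x)"] t x' by (simp add: T_def F_def)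
    then show ?thesis using on_L by (simp add: \<psi>_def)
  qed
  show ?thesis
  proof
    show "continuous_map ?P ?X \<Phi>" by (rule \<Phi>)
    show "\<Phi> (0, x) = x" if x: "x \<in> topspace ?X" for x
    proof (cases "supp x \<in> L")
      case True
      then have "x \<in> topspace ?Y" using x by (simp add: topspace_realization)
      then show ?thesis using at_L[of 0 x] H_0 by simp
    next
      case False
      then obtain i where i: "i < k" "supp x = R i" using cases_K[OF x] by blast
      have "(0, x) \<in> A i" using x i(2) s_bounds[OF x] by (simp add: A_def)
      then have "\<Phi> (0, x) = \<phi> i (0, x)"
        using \<Phi>_eq[of "Some i" "(0, x)"] i x by (simp add: T_def F_def)
      also have "\<dots> = x"
        using on_R[OF x i(1)] i(2) by (auto simp: \<phi>_def)
      finally show ?thesis .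
    qed
    show "\<Phi> (t, x) \<in> topspace ?Y" if "t \<in> {0..1}" "x \<in> topspace ?Y" for t x
      using at_L[OF that] continuous_map_funspace[OF H] that by auto
    show "\<Phi> (1, x) = a" if "x \<in> topspace ?Y" for x
      using at_L[of 1 x] that H_1 by simp
  qed
qed

section \<open>A simplex modulo its boundary is a sphere\<close>

abbreviation least_coord :: "nat \<Rightarrow> (nat \<Rightarrow> real) \<Rightarrow> real" where
  "least_coord d y \<equiv> Min (y ` {..d})"

text \<open>Divided by the square of the least coordinate, this is the squared norm of the
  stereographic coordinates used below; the term for j = 0 is 0.\<close>

definition spread :: "nat \<Rightarrow> (nat \<Rightarrow> real) \<Rightarrow> real" where
  "spread d y = (\<Sum>j\<le>d. (y j - y 0)\<^sup>2)"

text \<open>Inverse stereographic projection of the point with coordinates $(y_j - y_0) / \min y$,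
  $1 \le j \le d$, multiplied out so that the boundary $\min y = 0$ goes to the base point.\<close>

definition simplex_chart :: "nat \<Rightarrow> (nat \<Rightarrow> real) \<Rightarrow> nat \<Rightarrow> real" where
  "simplex_chart d y j =
     (if j = 0 then (spread d y - (least_coord d y)\<^sup>2) / (spread d y + (least_coord d y)\<^sup>2)
      else if j \<le> d then 2 * least_coord d y * (y j - y 0) / (spread d y + (least_coord d y)\<^sup>2)
      else 0)"

lemma spread_nonneg: "0 \<le> spread d y"
  by (simp add: spread_def sum_nonneg)

lemma spread_remove_0: "spread d y = (\<Sum>j\<in>{..d} - {0}. (y j - y 0)\<^sup>2)"
  unfolding spread_def by (subst sum.remove[of _ 0]) auto

lemma least_coord_le: "j \<le> d \<Longrightarrow> least_coord d y \<le> y j"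
  by (intro Min_le) auto

lemma least_coord_attained: "\<exists>j\<le>d. y j = least_coord d y"
  using Min_image_attained[of "{..d}" y] by auto

text \<open>This is the denominator of the chart. If it vanished, all coordinates would equal
  \<open>y 0\<close> and one of them would be 0, contradicting the total 1.\<close>

lemma spread_least_coord_pos:
  assumes "(\<Sum>j\<le>d. y j) = 1"
  shows "0 < spread d y + (least_coord d y)\<^sup>2"
proof (rule ccontr)
  assume "\<not> ?thesis"
  moreover have "0 \<le> (least_coord d y)\<^sup>2" by simp
  ultimately have 0: "spread d y = 0" "(least_coord d y)\<^sup>2 = 0"
    using spread_nonneg[of d y] by linarith+
  have const: "y j = y 0" if "j \<le> d" for j
  proof -
    have "(y j - y 0)\<^sup>2 \<le> spread d y"
      unfolding spread_def using that by (intro member_le_sum) auto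
    then show ?thesis using 0(1) by simp
  qed
  obtain i where "i \<le> d" "y i = 0" using least_coord_attained[of d y] 0(2) by auto
  then have "y 0 = 0" using const[of i] by simp
  then have "y j = 0" if "j \<le> d" for j using const[OF that] by simp
  then have "(\<Sum>j\<le>d. y j) = 0" by (intro sum.neutral) auto
  then show False using assms by simp
qed

text \<open>With Q the spread and \<mu> the least coordinate, this is the identity \<open>(Q -
  \<mu>\<^sup>2)\<^sup>2 + 4 * \<mu>\<^sup>2 * Q = (Q + \<mu>\<^sup>2)\<^sup>2\<close>.\<close>

lemma simplex_chart_in_nsphere:
  assumes "(\<Sum>j\<le>d. y j) = 1"
  shows "simplex_chart d y \<in> topspace (nsphere d)"
proof -
  define \<mu> Q where "\<mu> = least_coord d y" and "Q = spread d y"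
  define D where "D = Q + \<mu>\<^sup>2"
  have D: "D \<noteq> 0" using spread_least_coord_pos[OF assms] by (simp add: D_def \<mu>_def Q_def)
  have "(\<Sum>j\<le>d. (simplex_chart d y j)\<^sup>2) =
      (simplex_chart d y 0)\<^sup>2 + (\<Sum>j\<in>{..d} - {0}. (simplex_chart d y j)\<^sup>2)"
    by (rule sum.remove) auto
  also have "(\<Sum>j\<in>{..d} - {0}. (simplex_chart d y j)\<^sup>2) =
      (\<Sum>j\<in>{..d} - {0}. (2 * \<mu> / D)\<^sup>2 * (y j - y 0)\<^sup>2)"
    by (intro sum.cong)
      (auto simp: simplex_chart_def power_mult_distrib power_divide D_def \<mu>_def Q_def)
  also have "\<dots> = (2 * \<mu> / D)\<^sup>2 * Q"
    by (simp add: Q_def spread_remove_0 sum_distrib_left)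
  also have "simplex_chart d y 0 = (Q - \<mu>\<^sup>2) / D"
    by (simp add: simplex_chart_def D_def \<mu>_def Q_def)
  also have "((Q - \<mu>\<^sup>2) / D)\<^sup>2 + (2 * \<mu> / D)\<^sup>2 * Q = ((Q - \<mu>\<^sup>2)\<^sup>2 + (2 * \<mu>)\<^sup>2 * Q) / D\<^sup>2"
    by (simp add: power_divide add_divide_distrib)
  also have "(Q - \<mu>\<^sup>2)\<^sup>2 + (2 * \<mu>)\<^sup>2 * Q = D\<^sup>2"
    by (simp add: D_def power2_eq_square algebra_simps)
  also have "D\<^sup>2 / D\<^sup>2 = 1" using D by simp
  finally show ?thesis by (simp add: nsphere simplex_chart_def)
qed

text \<open>Stereographic projection divides by this quantity. It vanishes exactly when the least
  coordinate does, and multiplying it by (y j - y 0) / \<mu> gives the j-th chart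
  coordinate.\<close>

lemma one_minus_simplex_chart_0:
  assumes "(\<Sum>j\<le>d. y j) = 1"
  shows "1 - simplex_chart d y 0 = 2 * (least_coord d y)\<^sup>2 / (spread d y + (least_coord d y)\<^sup>2)"
  using spread_least_coord_pos[OF assms] by (simp add: simplex_chart_def field_simps)

lemma simplex_chart_eq_base_iff:
  assumes "(\<Sum>j\<le>d. y j) = 1"
  shows "simplex_chart d y = nsphere_base \<longleftrightarrow> least_coord d y = 0"
proof
  assume "simplex_chart d y = nsphere_base"
  then have "simplex_chart d y 0 = 1" by (simp add: nsphere_base_def)
  then show "least_coord d y = 0"
    using one_minus_simplex_chart_0[OF assms] spread_least_coord_pos[OF assms] by simp
next
  assume 0: "least_coord d y = 0"
  then have "spread d y \<noteq> 0" using spread_least_coord_pos[OF assms] by simp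
  with 0 show "simplex_chart d y = nsphere_base"
    by (auto simp: simplex_chart_def nsphere_base_def)
qed

text \<open>Equal stereographic coordinates make \<open>z\<close> an affine function of
  \<open>y\<close> with positive slope. Comparing the two minima removes the constant term, and the
  common total 1 makes the slope 1.\<close>

lemma simplex_chart_inj:
  assumes y: "(\<Sum>j\<le>d. y j) = 1" "0 < least_coord d y"
    and z: "(\<Sum>j\<le>d. z j) = 1" "0 < least_coord d z"
    and eq: "simplex_chart d y = simplex_chart d z" and j: "j \<le> d"
  shows "y j = z j"
proof -
  have ratio: "simplex_chart d x j = (1 - simplex_chart d x 0) * ((x j - x 0) / least_coord d x)"
    if "(\<Sum>j\<le>d. x j) = 1" "0 < least_coord d x" "0 < j" "j \<le> d" for x j
    unfolding one_minus_simplex_chart_0[OF that(1)]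
    using that by (simp add: simplex_chart_def power2_eq_square)
  have ne: "1 - simplex_chart d y 0 \<noteq> 0"
    using less_imp_neq[OF y(2)] spread_least_coord_pos[OF y(1)]
    unfolding one_minus_simplex_chart_0[OF y(1)] by simp
  let ?\<mu> = "least_coord d y" and ?\<nu> = "least_coord d z"
  \<comment> \<open>Equality of the ratios says that z j * ?\<mu> - y j * ?\<nu> does not depend on
    j; \<open>c\<close> is its value at j = 0.\<close>
  define c where "c = z 0 * ?\<mu> - y 0 * ?\<nu>"
  have affine: "z j * ?\<mu> = y j * ?\<nu> + c" if "j \<le> d" for j
  proof (cases "j = 0")
    case False
    then have "0 < j" by simp
    from ratio[OF y this that] ratio[OF z this that]
    have "(1 - simplex_chart d z 0) * ((y j - y 0) / ?\<mu>) = (1 - simplex_chart d z 0) * ((z j - z 0) / ?\<nu>)"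
      unfolding eq by (rule subst)
    then have "(y j - y 0) / ?\<mu> = (z j - z 0) / ?\<nu>"
      using ne unfolding eq mult_cancel_left by blast
    then show ?thesis using y(2) z(2) by (simp add: c_def field_simps)
  qed (simp add: c_def)
  \<comment> \<open>Where \<open>y\<close> is least, \<open>z\<close> is at least its own minimum,
    which gives c \<ge> 0. Exchanging \<open>y\<close> and \<open>z\<close> gives c \<le> 0.\<close>
  obtain a where a: "a \<le> d" "y a = ?\<mu>" using least_coord_attained by blast
  have "?\<nu> * ?\<mu> \<le> z a * ?\<mu>"
    by (rule mult_right_mono[OF least_coord_le[OF a(1)] less_imp_le[OF y(2)]])
  then have "0 \<le> c" using affine[OF a(1)] unfolding a(2) mult.commute[of ?\<mu> ?\<nu>] by linarith
  obtain b where b: "b \<le> d" "z b = ?\<nu>" using least_coord_attained by blast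
  have "?\<mu> * ?\<nu> \<le> y b * ?\<nu>"
    by (rule mult_right_mono[OF least_coord_le[OF b(1)] less_imp_le[OF z(2)]])
  then have "c \<le> 0" using affine[OF b(1)] unfolding b(2) mult.commute[of ?\<mu> ?\<nu>] by linarith
  with \<open>0 \<le> c\<close> have affine: "z j * ?\<mu> = y j * ?\<nu>" if "j \<le> d" for j
    using affine[OF that] by simp
  have "(\<Sum>j\<le>d. z j) * ?\<mu> = (\<Sum>j\<le>d. y j) * ?\<nu>"
    unfolding sum_distrib_right using affine by (intro sum.cong) auto
  then have "?\<mu> = ?\<nu>" using y z by simp
  then show ?thesis using affine[OF j] z(2) by simp
qed

text \<open>The stereographic coordinates of \<open>p\<close> are p j / (1 - p 0). The preimage
  needs coordinates whose differences from the zeroth, divided by the minimum, are these numbers; a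
  shift adjusts the minimum and a scaling adjusts the total.\<close>

lemma simplex_chart_surj:
  assumes p: "p \<in> topspace (nsphere d)" and ne: "p \<noteq> nsphere_base"
  obtains y where "\<And>j. j \<le> d \<Longrightarrow> 0 < y j" and "(\<Sum>j\<le>d. y j) = 1" and "simplex_chart d y = p"
proof -
  have p: "(\<Sum>j\<le>d. (p j)\<^sup>2) = 1" "\<And>j. d < j \<Longrightarrow> p j = 0"
    using p by (auto simp: nsphere)
  \<comment> \<open>The entry at 0 is reset because \<open>y 0\<close> is the reference coordinate:
    its difference from itself must be 0.\<close>
  let ?q = "p(0 := 0)"
  have "(\<Sum>j\<le>d. (p j)\<^sup>2) = (p 0)\<^sup>2 + (\<Sum>j\<in>{..d} - {0}. (p j)\<^sup>2)"
    by (rule sum.remove) auto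
  also have "(\<Sum>j\<in>{..d} - {0}. (p j)\<^sup>2) = (\<Sum>j\<le>d. (?q j)\<^sup>2)"
    by (intro sum.mono_neutral_cong_left) auto
  finally have q: "(\<Sum>j\<le>d. (?q j)\<^sup>2) = 1 - (p 0)\<^sup>2" using p(1) by simp
  have "p 0 \<noteq> 1"
  proof
    assume p0: "p 0 = 1"
    have q0: "?q j = 0" if "j \<le> d" for j
    proof -
      have "(?q j)\<^sup>2 \<le> (\<Sum>j\<le>d. (?q j)\<^sup>2)"
        using that by (intro member_le_sum) auto
      then show ?thesis using q p0 by simp
    qed
    have "p j = nsphere_base j" for j
      using p0 p(2)[of j] q0[of j] by (cases "j \<le> d"; cases "j = 0") (auto simp: nsphere_base_def)
    then show False using ne by auto
  qed
  moreover have "(p 0)\<^sup>2 \<le> 1"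
    using q sum_nonneg[of "{..d}" "\<lambda>j. (?q j)\<^sup>2"] by simp
  ultimately have c: "0 < 1 - p 0"
    using abs_square_le_1[of "p 0"] by auto
  define c where "c = 1 - p 0"
  define m where "m = least_coord d ?q"
  define N where "N = (\<Sum>j\<le>d. ?q j - m + c)"
  have c: "0 < c" using c by (simp add: c_def)
  have z: "c \<le> ?q j - m + c" if "j \<le> d" for j
    using least_coord_le[OF that, of ?q] by (simp add: m_def)
  have N: "0 < N"
    unfolding N_def using less_le_trans[OF c z] by (intro sum_pos) blast+
  \<comment> \<open>Before division by \<open>N\<close> the least entry is c = 1 - p 0 and the
    differences from the zeroth entry are the \<open>?q j\<close>, so the quotients are p j / (1 - p
    0) as required.\<close>
  define y where "y = (\<lambda>j. (?q j - m + c) / N)"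
  have least: "least_coord d y = c / N"
  proof (rule Min_eqI)
    obtain a where "a \<le> d" "?q a = m" using least_coord_attained unfolding m_def by blast
    then show "c / N \<in> y ` {..d}" by (intro image_eqI[of _ _ a]) (auto simp: y_def)
    show "c / N \<le> u" if "u \<in> y ` {..d}" for u
      using that z N by (auto simp: y_def intro!: divide_right_mono)
  qed simp
  have diff: "y j - y 0 = ?q j / N" for j
    by (simp add: y_def flip: diff_divide_distrib)
  have "spread d y = (\<Sum>j\<le>d. (?q j)\<^sup>2) / N\<^sup>2"
    unfolding spread_def diff by (simp only: power_divide sum_divide_distrib)
  then have spread: "spread d y = (1 - (p 0)\<^sup>2) / N\<^sup>2" using q by simp
  have p0: "p 0 = 1 - c" by (simp add: c_def)
  have D: "spread d y + (least_coord d y)\<^sup>2 = 2 * c / N\<^sup>2"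
    unfolding spread least p0
    by (simp add: power_divide power2_eq_square algebra_simps flip: add_divide_distrib)
  have D': "spread d y - (least_coord d y)\<^sup>2 = 2 * c * (1 - c) / N\<^sup>2"
    unfolding spread least p0
    by (simp add: power_divide power2_eq_square algebra_simps flip: diff_divide_distrib)
  show ?thesis
  proof
    show "0 < y j" if "j \<le> d" for j
      unfolding y_def using z[OF that] c N by (intro divide_pos_pos) auto
    show "(\<Sum>j\<le>d. y j) = 1"
      unfolding y_def sum_divide_distrib[symmetric] using N by (simp add: N_def)
    show "simplex_chart d y = p"
    proof
      fix j
      consider "j = 0" | "0 < j" "j \<le> d" | "d < j" by linarith
      then show "simplex_chart d y j = p j"
      proof cases
        case 1
        then show ?thesis unfolding simplex_chart_def D D' using c N by (simp add: p0)
      next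
        case 2
        then show ?thesis
          unfolding simplex_chart_def D unfolding least diff using c N by (simp add: power2_eq_square)
      next
        case 3
        then show ?thesis using p(2)[of j] by (simp add: simplex_chart_def)
      qed
    qed
  qed
qed

lemma continuous_map_simplex_chart:
  assumes y: "\<And>j. j \<le> d \<Longrightarrow> continuous_map X euclideanreal (\<lambda>x. y x j)"
    and sum: "\<And>x. x \<in> topspace X \<Longrightarrow> (\<Sum>j\<le>d. y x j) = 1"
  shows "continuous_map X (nsphere d) (\<lambda>x. simplex_chart d (y x))"
proof -
  have least: "continuous_map X euclideanreal (\<lambda>x. least_coord d (y x))"
    using continuous_map_Min[of "{..d}" X "\<lambda>j x. y x j"] y by simp
  have spread: "continuous_map X euclideanreal (\<lambda>x. spread d (y x))"
    unfolding spread_def power2_eq_square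
    by (intro continuous_map_sum continuous_map_real_mult continuous_map_diff y) auto
  have "continuous_map X euclideanreal (\<lambda>x. simplex_chart d (y x) j)" for j
  proof -
    have D: "spread d (y x) + (least_coord d (y x))\<^sup>2 \<noteq> 0" if "x \<in> topspace X" for x
      using spread_least_coord_pos[OF sum[OF that]] by simp
    consider "j = 0" | "0 < j" "j \<le> d" | "d < j" by linarith
    then show ?thesis
    proof cases
      case 1
      with D show ?thesis unfolding simplex_chart_def power2_eq_square
        by (simp, intro continuous_map_real_divide continuous_map_diff continuous_map_add
            continuous_map_real_mult spread least)
    next
      case 2
      with D show ?thesis unfolding simplex_chart_def power2_eq_square
        by (simp, intro continuous_map_real_divide continuous_map_diff continuous_map_add
            continuous_map_real_mult spread least y) auto
    next
      case 3
      then show ?thesis unfolding simplex_chart_def by simp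
    qed
  qed
  moreover have "simplex_chart d (y x) \<in> topspace (nsphere d)" if "x \<in> topspace X" for x
    using sum[OF that] by (rule simplex_chart_in_nsphere)
  ultimately show ?thesis
    unfolding nsphere continuous_map_in_subtopology continuous_map_componentwise_UNIV
    by (auto simp: nsphere)
qed

section \<open>Attaching cells to a contractible complex\<close>

lemma Hausdorff_realization: "Hausdorff_space (geometric_realization K)"
  unfolding geometric_realization_def
  by (intro Hausdorff_space_subtopology) (simp add: Hausdorff_space_product_topology)

text \<open>The simplex is a closed subset of a product of copies of [0,1] and {0}, which is compact
  by Tychonoff. Compactness makes the charts closed maps and the cells closed subsets.\<close>

lemma compact_realization_simplex:
  assumes "finite \<rho>"
  shows "compact_space (geometric_realization (Pow \<rho>))"
proof -
  let ?X = "powertop_real UNIV"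
  let ?S = "topspace (geometric_realization (Pow \<rho>))"
  let ?B = "PiE UNIV (\<lambda>v. if v \<in> \<rho> then {0..1::real} else {0})"
  have B: "compactin ?X ?B"
    by (simp add: compactin_PiE)
  have c: "continuous_map ?X euclideanreal (\<lambda>x. x v)" for v
    by (rule continuous_map_product_projection) simp
  have "closedin ?X {x \<in> topspace ?X. (\<Sum>v\<in>\<rho>. x v) \<in> {1}}"
    by (intro closedin_continuous_map_preimage[where Y = euclideanreal] continuous_map_sum c assms) auto
  moreover have "closedin ?X ?B"
    using B by (intro compactin_imp_closedin) (simp_all add: Hausdorff_space_product_topology)
  ultimately have "closedin ?X (?B \<inter> {x \<in> topspace ?X. (\<Sum>v\<in>\<rho>. x v) \<in> {1}})"
    by (intro closedin_Int)
  also have "?B \<inter> {x \<in> topspace ?X. (\<Sum>v\<in>\<rho>. x v) \<in> {1}} = ?S"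
  proof (intro equalityI subsetI)
    fix x assume "x \<in> ?B \<inter> {x \<in> topspace ?X. (\<Sum>v\<in>\<rho>. x v) \<in> {1}}"
    then have x: "x v \<in> (if v \<in> \<rho> then {0..1} else {0})" "(\<Sum>v\<in>\<rho>. x v) = 1" for v
      by (auto simp: PiE_iff)
    have "v \<in> \<rho>" if "v \<in> supp x" for v using that x(1)[of v] by (auto split: if_splits)
    then have "supp x \<subseteq> \<rho>" by blast
    moreover have "0 \<le> x v" for v using x(1)[of v] by (auto split: if_splits)
    ultimately show "x \<in> ?S"
      using x(2) sum_supp_superset[OF assms] by (simp add: topspace_realization)
  next
    fix x assume x: "x \<in> ?S"
    then have sub: "supp x \<subseteq> \<rho>" and sum: "(\<Sum>v\<in>\<rho>. x v) = 1"
      using realizationD[OF x] assms by auto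
    have "x v \<le> 1" if "v \<in> \<rho>" for v
      using member_le_sum[OF that, of x] realizationD(1)[OF x] assms sum by simp
    then show "x \<in> ?B \<inter> {x \<in> topspace ?X. (\<Sum>v\<in>\<rho>. x v) \<in> {1}}"
      using realizationD(1)[OF x] sub sum by (auto simp: PiE_iff)
  qed
  finally have "closedin ?X ?S" .
  moreover have "?S \<subseteq> ?B"
  proof
    fix x assume x: "x \<in> ?S"
    then have sub: "supp x \<subseteq> \<rho>" and sum: "(\<Sum>v\<in>\<rho>. x v) = 1"
      using realizationD[OF x] assms by auto
    have "x v \<le> 1" if "v \<in> \<rho>" for v
      using member_le_sum[OF that, of x] realizationD(1)[OF x] assms sum by simp
    then show "x \<in> ?B"
      using realizationD(1)[OF x] sub by (auto simp: PiE_iff)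
  qed
  ultimately have "compactin ?X ?S" using B by (intro closed_compactin[of ?X ?B ?S])
  then show ?thesis
    unfolding geometric_realization_def
    by (simp add: compactin_subspace compact_space_subtopology topspace_realization)
qed

text \<open>The map \<open>f\<close> sends \<open>L\<close> to the base point and each open cell to
  its own sphere by \<open>simplex_chart\<close>. It is a closed surjection, hence a quotient map,
  and it identifies nothing except the points of \<open>L\<close> with each other. The extended
  contraction of \<open>L\<close> then shows that passing to the quotient preserves the homotopy
  type.\<close>

lemma wedge_of_attached_cells:
  fixes R :: "nat \<Rightarrow> 'a set"
  assumes L: "abstract_complex L" and K: "K = L \<union> R ` {..<k}" and k: "0 < k"
    and card: "\<And>i. i < k \<Longrightarrow> card (R i) = Suc d" and inj: "inj_on R {..<k}"
    and notin: "\<And>i. i < k \<Longrightarrow> R i \<notin> L" and boundary: "\<And>i \<tau>. i < k \<Longrightarrow> \<tau> \<subset> R i \<Longrightarrow> \<tau> \<in> L"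
    and contr: "contractible_space (geometric_realization L)"
    and nonempty: "topspace (geometric_realization L) \<noteq> {}"
  shows "geometric_realization K homotopy_equivalent_space wedge_of_spheres k d"
proof -
  let ?X = "geometric_realization K" and ?Y = "geometric_realization L"
  let ?W = "wedge_of_spheres k d"
  let ?C = "\<lambda>i. geometric_realization (Pow (R i))"
  obtain \<Phi> a where \<Phi>:
    "continuous_map (prod_topology (top_of_set {0..1::real}) ?X) ?X \<Phi>"
    "\<And>x. x \<in> topspace ?X \<Longrightarrow> \<Phi> (0, x) = x"
    "\<And>t x. t \<in> {0..1} \<Longrightarrow> x \<in> topspace ?Y \<Longrightarrow> \<Phi> (t, x) \<in> topspace ?Y"
    "\<And>x. x \<in> topspace ?Y \<Longrightarrow> \<Phi> (1, x) = a"
  proof -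
    show thesis
      by (rule extend_contraction[where K = K and L = L and R = R and k = k and d = d])
        (fact L K card inj notin boundary contr that)+
  qed
  have finR: "finite (R i)" and neR: "R i \<noteq> {}" if "i < k" for i
    using card[OF that] by (auto intro: card_ge_0_finite)
  have "\<exists>e. bij_betw e {..d} (R i)" if "i < k" for i
    using ex_bij_betw_nat_finite[OF finR[OF that]] card[OF that]
    by (simp add: atLeast0LessThan lessThan_Suc_atMost)
  then obtain e where e: "\<And>i. i < k \<Longrightarrow> bij_betw (e i) {..d} (R i)" by metis
  have sub_K: "Pow (R i) \<subseteq> K" if "i < k" for i
    using boundary[OF that] that by (auto simp: K)
  have C_X: "topspace (?C i) \<subseteq> topspace ?X" if "i < k" for i
    by (rule realization_mono[OF sub_K[OF that]])
  have R_sub: "i = j" if "i < k" "j < k" "R i \<subseteq> R j" for i j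
    using that card_subset_eq[OF finR[OF that(2)] that(3)] card inj by (auto dest: inj_onD)
  define y where "y = (\<lambda>i (x :: 'a \<Rightarrow> real) j. x (e i j))"
  define \<zeta> where "\<zeta> = (\<lambda>i x. simplex_chart d (y i x))"
  define \<iota> where "\<iota> = (\<lambda>(i::nat, p). if p = nsphere_base then None else Some (i, p))"
  define f where "f = (\<lambda>x. if \<exists>i<k. supp x = R i
      then let i = (THE i. i < k \<and> supp x = R i) in Some (i, \<zeta> i x) else None)"
  have W: "?W = quotient_topology (sum_topology (\<lambda>_. nsphere d) {..<k}) \<iota>"
    by (simp add: wedge_of_spheres_def wedge_def \<iota>_def)
  have \<iota>: "quotient_map (sum_topology (\<lambda>_. nsphere d) {..<k}) ?W \<iota>"
    unfolding W by (rule quotient_map_quotient_topology)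
  have sum_y: "(\<Sum>j\<le>d. y i x j) = 1" if i: "i < k" and x: "x \<in> topspace (?C i)" for i x
    using sum.reindex_bij_betw[OF e[OF i], of x] realizationD(3)[OF x finR[OF i]]
      realizationD(2)[OF x] by (simp add: y_def)
  have least_pos: "0 < least_coord d (y i x) \<longleftrightarrow> supp x = R i"
    and least_nonneg: "0 \<le> least_coord d (y i x)"
    if i: "i < k" and x: "x \<in> topspace (?C i)" for i x
  proof -
    have R: "R i = e i ` {..d}" using e[OF i] by (simp add: bij_betw_def)
    have sub: "supp x \<subseteq> R i" using realizationD(2)[OF x] by simp
    obtain b where b: "b \<le> d" "x (e i b) = least_coord d (y i x)"
      using least_coord_attained[of d "y i x"] by (auto simp: y_def)
    show "0 \<le> least_coord d (y i x)" using realizationD(1)[OF x, of "e i b"] b(2) by simp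
    show "0 < least_coord d (y i x) \<longleftrightarrow> supp x = R i"
    proof
      assume pos: "0 < least_coord d (y i x)"
      have "x (e i j) \<noteq> 0" if "j \<le> d" for j
        using less_le_trans[OF pos least_coord_le[OF that]] by (simp add: y_def)
      then show "supp x = R i" using sub R by auto
    next
      assume "supp x = R i"
      then have "x (e i b) \<noteq> 0" using R b(1) by auto
      then show "0 < least_coord d (y i x)"
        using realizationD(1)[OF x, of "e i b"] unfolding b(2) by linarith
    qed
  qed
  have base: "\<zeta> i x = nsphere_base \<longleftrightarrow> supp x \<noteq> R i"
    if i: "i < k" and x: "x \<in> topspace (?C i)" for i x
    using simplex_chart_eq_base_iff[OF sum_y[OF i x]] least_pos[OF i x] least_nonneg[OF i x]
    by (auto simp: \<zeta>_def less_le)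
  have f_Some: "f x = Some (i, \<zeta> i x)" if "i < k" "supp x = R i" for i x
  proof -
    have "(THE i. i < k \<and> supp x = R i) = i"
      using that R_sub by (intro the_equality) auto
    then show ?thesis using that by (auto simp: f_def Let_def)
  qed
  have f_None: "f x = None" if "supp x \<in> L" for x
    using that notin by (auto simp: f_def)
  \<comment> \<open>One formula covers the closed cell: the chart takes the base point as value
    exactly on the boundary, and \<open>\<iota>\<close> sends the base point to
    \<open>None\<close>.\<close>
  have f_C: "f x = \<iota> (i, \<zeta> i x)" if i: "i < k" and x: "x \<in> topspace (?C i)" for i x
  proof (cases "supp x = R i")
    case True
    then show ?thesis using base[OF i x] f_Some[OF i] by (simp add: \<iota>_def)
  next
    case False
    then have "supp x \<in> L" using boundary[OF i] realizationD(2)[OF x] by blast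
    then show ?thesis using base[OF i x] f_None False by (simp add: \<iota>_def)
  qed
  have cases_K: "supp x \<in> L \<or> (\<exists>i<k. supp x = R i)" if "x \<in> topspace ?X" for x
    using realizationD(2)[OF that] K by auto
  have in_C: "x \<in> topspace (?C i)" if "x \<in> topspace ?X" "supp x \<subseteq> R i" for x i
    using that by (auto simp: topspace_realization)
  have c\<zeta>: "continuous_map (?C i) (nsphere d) (\<zeta> i)" if i: "i < k" for i
    unfolding \<zeta>_def by (rule continuous_map_simplex_chart)
      (auto simp: y_def continuous_map_coordinate intro: sum_y[OF i, unfolded y_def])
  have closed_\<zeta>: "closed_map (?C i) (nsphere d) (\<zeta> i)" if i: "i < k" for i
    by (rule continuous_imp_closed_map[OF c\<zeta>[OF i] compact_realization_simplex[OF finR[OF i]]])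
      (simp add: nsphere_def Hausdorff_space_subtopology Hausdorff_Euclidean_space)
  have C_sub: "?C i = subtopology ?X (topspace (?C i))" if "i < k" for i
    by (rule realization_subcomplex[OF sub_K[OF that]])
  have closed_C: "closedin ?X (topspace (?C i))" if i: "i < k" for i
  proof (rule compactin_imp_closedin[OF Hausdorff_realization])
    have "compact_space (subtopology ?X (topspace (?C i)))"
      using compact_realization_simplex[OF finR[OF i]] C_sub[OF i] by simp
    then show "compactin ?X (topspace (?C i))"
      using C_X[OF i] by (simp add: compactin_subspace)
  qed
  \<comment> \<open>This describes \<open>L\<close> by the vanishing of finitely many continuous
    functions, so that it is visibly closed.\<close>
  have Y_eq: "topspace ?Y = {x \<in> topspace ?X. \<forall>i<k. Min (x ` R i) \<in> {0}}"
  proof (intro equalityI subsetI)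
    fix x assume x: "x \<in> topspace ?Y"
    then have x': "x \<in> topspace ?X" using realization_mono[of L K] K by blast
    have "Min (x ` R i) = 0" if i: "i < k" for i
    proof -
      have "\<not> R i \<subseteq> supp x"
        using notin[OF i] abstract_complexD(2)[OF L realizationD(2)[OF x]] by blast
      then obtain v where v: "v \<in> R i" "x v = 0" by auto
      show ?thesis
        using v finR[OF i] realizationD(1)[OF x] by (intro Min_eqI) force+
    qed
    then show "x \<in> {x \<in> topspace ?X. \<forall>i<k. Min (x ` R i) \<in> {0}}" using x' by simp
  next
    fix x assume x: "x \<in> {x \<in> topspace ?X. \<forall>i<k. Min (x ` R i) \<in> {0}}"
    have "supp x \<noteq> R i" if i: "i < k" for i
      using Min_image_attained[OF finR[OF i] neR[OF i], of x] x i by auto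
    then have "supp x \<in> L" using cases_K x by blast
    then show "x \<in> topspace ?Y" using x by (simp add: topspace_realization)
  qed
  have closed_Y: "closedin ?X (topspace ?Y)"
  proof -
    have "continuous_map ?X euclideanreal (\<lambda>x. Min (x ` R i))" if "i < k" for i
      using continuous_map_Min[OF finR[OF that] neR[OF that], of ?X "\<lambda>v x. x v"]
      by (simp add: continuous_map_coordinate)
    then have "closedin ?X {x \<in> topspace ?X. Min (x ` R i) \<in> {0}}" if "i < k" for i
      using that by (intro closedin_continuous_map_preimage) auto
    then have "closedin ?X (\<Inter>i\<in>{..<k}. {x \<in> topspace ?X. Min (x ` R i) \<in> {0}})"
      using k by (intro closedin_INT) auto
    also have "(\<Inter>i\<in>{..<k}. {x \<in> topspace ?X. Min (x ` R i) \<in> {0}}) = topspace ?Y"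
      unfolding Y_eq using k by auto
    finally show ?thesis .
  qed
  have None_W: "None \<in> topspace ?W"
    unfolding W topspace_quotient_topology using k nsphere_base_in_nsphere[of d]
    by (auto simp: \<iota>_def image_iff split: if_splits intro!: bexI[of _ "(0, nsphere_base)"])
  have cf: "continuous_map ?X ?W f"
  proof (rule pasting_lemma_closed[of "insert None (Some ` {..<k})" ?X
        "case_option (topspace ?Y) (\<lambda>i. topspace (?C i))" ?W
        "case_option (\<lambda>_. None) (\<lambda>i x. \<iota> (i, \<zeta> i x))"])
    show "closedin ?X (case_option (topspace ?Y) (\<lambda>i. topspace (?C i)) j)"
      if "j \<in> insert None (Some ` {..<k})" for j
      using that closed_Y closed_C by auto
    show "continuous_map (subtopology ?X (case_option (topspace ?Y) (\<lambda>i. topspace (?C i)) j)) ?W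
        (case_option (\<lambda>_. None) (\<lambda>i x. \<iota> (i, \<zeta> i x)) j)"
      if j: "j \<in> insert None (Some ` {..<k})" for j
    proof (cases j)
      case None
      then show ?thesis using None_W by simp
    next
      case (Some i)
      then have i: "i < k" using j by auto
      have "continuous_map (?C i) ?W (\<iota> \<circ> (\<lambda>p. (i, p)) \<circ> \<zeta> i)"
        using i by (intro continuous_map_compose[OF c\<zeta>] continuous_map_compose[OF
              continuous_map_component_injection quotient_imp_continuous_map[OF \<iota>]]) auto
      then show ?thesis using C_sub[OF i] Some by (simp add: o_def)
    qed
    show "case_option (\<lambda>_. None) (\<lambda>i x. \<iota> (i, \<zeta> i x)) j x
        = case_option (\<lambda>_. None) (\<lambda>i x. \<iota> (i, \<zeta> i x)) j' x"
      if "j \<in> insert None (Some ` {..<k})" "j' \<in> insert None (Some ` {..<k})"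
        "x \<in> topspace ?X \<inter> case_option (topspace ?Y) (\<lambda>i. topspace (?C i)) j
          \<inter> case_option (topspace ?Y) (\<lambda>i. topspace (?C i)) j'" for j j' x
    proof -
      have "case_option (\<lambda>_. None) (\<lambda>i x. \<iota> (i, \<zeta> i x)) j x = f x"
        if "j \<in> insert None (Some ` {..<k})"
          "x \<in> case_option (topspace ?Y) (\<lambda>i. topspace (?C i)) j" for j
        using that f_C f_None realizationD(2)[of x L] by (cases j) auto
      then show ?thesis using that by auto
    qed
    show "\<exists>j. j \<in> insert None (Some ` {..<k})
        \<and> x \<in> case_option (topspace ?Y) (\<lambda>i. topspace (?C i)) j
        \<and> f x = case_option (\<lambda>_. None) (\<lambda>i x. \<iota> (i, \<zeta> i x)) j x"
      if x: "x \<in> topspace ?X" for x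
    proof (cases "supp x \<in> L")
      case True
      then have "x \<in> topspace ?Y" using x by (simp add: topspace_realization)
      then show ?thesis using f_None[OF True] by (intro exI[of _ None]) simp
    next
      case False
      then obtain i where i: "i < k" "supp x = R i" using cases_K[OF x] by blast
      then show ?thesis using in_C[OF x, of i] f_C[OF i(1)] by (intro exI[of _ "Some i"]) simp
    qed
  qed simp
  have surj: "f ` topspace ?X = topspace ?W"
  proof (intro equalityI subsetI)
    show "w \<in> topspace ?W" if "w \<in> f ` topspace ?X" for w
      using that continuous_map_image_subset_topspace[OF cf] by blast
    fix w assume w: "w \<in> topspace ?W"
    then consider "w = None" | i p where "w = Some (i, p)" "i < k" "p \<in> topspace (nsphere d)" "p \<noteq> nsphere_base"
      unfolding W topspace_quotient_topology by (auto simp: \<iota>_def split: if_splits)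
    then show "w \<in> f ` topspace ?X"
    proof cases
      case 1
      obtain x where x: "x \<in> topspace ?Y" using nonempty by blast
      then have "f x = None" "x \<in> topspace ?X"
        using f_None realizationD(2)[OF x] realization_mono[of L K] K by auto
      then show ?thesis using 1 by (metis imageI)
    next
      case 2
      note i = \<open>i < k\<close>
      obtain z where z: "\<And>j. j \<le> d \<Longrightarrow> 0 < z j" "(\<Sum>j\<le>d. z j) = 1" "simplex_chart d z = p"
        using simplex_chart_surj[OF 2(3,4)] by blast
      define x where "x = (\<lambda>v. if v \<in> R i then z (inv_into {..d} (e i) v) else 0)"
      have x_e: "x (e i j) = z j" if "j \<le> d" for j
        using that e[OF i] by (auto simp: x_def bij_betw_def)
      have pos: "0 < x v" if "v \<in> R i" for v
      proof -
        from that e[OF i] obtain j where "j \<le> d" "v = e i j" by (auto simp: bij_betw_def)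
        then show ?thesis using x_e z(1) by simp
      qed
      have supp: "supp x = R i"
        using pos by (force simp: x_def)
      have "(\<Sum>v\<in>R i. x v) = (\<Sum>j\<le>d. z j)"
        using sum.reindex_bij_betw[OF e[OF i], of x] x_e by simp
      then have x: "x \<in> topspace ?X"
        using z(2) supp i pos by (auto simp: topspace_realization K x_def less_imp_le)
      have "simplex_chart d (y i x) = simplex_chart d z"
      proof -
        have "spread d (y i x) = spread d z" "y i x ` {..d} = z ` {..d}"
          using x_e by (auto simp: spread_def y_def image_iff)
        then show ?thesis using x_e by (intro ext) (simp add: simplex_chart_def y_def)
      qed
      then have "f x = w" using f_Some[OF i supp] z(3) 2(1) by (simp add: \<zeta>_def)
      then show ?thesis using x by blast
    qed
  qed
  have "closed_map ?X ?W f"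
    unfolding closed_map_def
  proof (intro allI impI)
    fix C assume C: "closedin ?X C"
    then have C_sub_X: "C \<subseteq> topspace ?X" by (rule closedin_subset)
    have fC: "f ` C \<subseteq> topspace ?W" using C_sub_X surj by blast
    let ?S = "sum_topology (\<lambda>_. nsphere d) {..<k}"
    have "closedin ?S {z \<in> topspace ?S. \<iota> z \<in> f ` C}"
      unfolding closedin_sum_topology
    proof (intro conjI ballI)
      fix i assume "i \<in> {..<k}"
      then have i: "i < k" by simp
      have "closedin (?C i) (topspace (?C i) \<inter> C)"
        using C C_sub[OF i] by (metis closedin_subtopology_Int_closed)
      then have "closedin (nsphere d) (\<zeta> i ` (topspace (?C i) \<inter> C))"
        using closed_\<zeta>[OF i] by (simp add: closed_map_def)
      moreover have "closedin (nsphere d) (if None \<in> f ` C then {nsphere_base} else {})"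
        using nsphere_base_in_nsphere[of d] closedin_Hausdorff_singleton[of "nsphere d"]
        by (simp add: nsphere_def Hausdorff_space_subtopology Hausdorff_Euclidean_space)
      ultimately have "closedin (nsphere d) (\<zeta> i ` (topspace (?C i) \<inter> C)
          \<union> (if None \<in> f ` C then {nsphere_base} else {}))"
        by (rule closedin_Un)
      also have "\<zeta> i ` (topspace (?C i) \<inter> C) \<union> (if None \<in> f ` C then {nsphere_base} else {})
          = {p. (i, p) \<in> {z \<in> topspace ?S. \<iota> z \<in> f ` C}}" (is "?l = ?r")
      proof (intro equalityI subsetI)
        fix p assume "p \<in> ?l"
        then consider x where "x \<in> topspace (?C i)" "x \<in> C" "p = \<zeta> i x"
          | "None \<in> f ` C" "p = nsphere_base" by (auto split: if_splits)
        then show "p \<in> ?r"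
        proof cases
          case 1
          then have "\<iota> (i, p) \<in> f ` C" using f_C[OF i, of x] by (metis imageI)
          moreover have "p \<in> topspace (nsphere d)"
            using 1 continuous_map_image_subset_topspace[OF c\<zeta>[OF i]] by blast
          ultimately show ?thesis using i by simp
        next
          case 2
          then show ?thesis using i nsphere_base_in_nsphere by (simp add: \<iota>_def)
        qed
      next
        fix p assume "p \<in> ?r"
        then have "\<iota> (i, p) \<in> f ` C" by simp
        then obtain x where x: "x \<in> C" "f x = \<iota> (i, p)" by (metis imageE)
        show "p \<in> ?l"
        proof (cases "p = nsphere_base")
          case True
          then have "f x = None" using x by (simp add: \<iota>_def)
          then have "None \<in> f ` C" using x(1) by (metis imageI)
          then show ?thesis using True by simp
        next
          case False
          then have fx: "f x = Some (i, p)" using x by (simp add: \<iota>_def)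
          have x': "x \<in> topspace ?X" using x C_sub_X by blast
          have "supp x \<notin> L" using fx f_None[of x] by auto
          then obtain j where "j < k" "supp x = R j" using cases_K[OF x'] by blast
          then have "supp x = R i" "p = \<zeta> i x" using f_Some[of j x] fx by auto
          then show ?thesis using in_C[OF x', of i] x(1) by auto
        qed
      qed
      finally show "closedin (nsphere d) {p. (i, p) \<in> {z \<in> topspace ?S. \<iota> z \<in> f ` C}}" .
    qed auto
    then show "closedin ?W (f ` C)"
      using \<iota> fC unfolding quotient_map_closedin by blast
  qed
  then have q: "quotient_map ?X ?W f"
    using cf surj by (intro continuous_closed_imp_quotient_map) auto
  have fibres: "f x = f x' \<longleftrightarrow> x = x' \<or> x \<in> topspace ?Y \<and> x' \<in> topspace ?Y"
    if x: "x \<in> topspace ?X" "x' \<in> topspace ?X" for x x'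
  proof -
    have in_Y: "z \<in> topspace ?Y \<longleftrightarrow> supp z \<in> L" if "z \<in> topspace ?X" for z
      using that by (auto simp: topspace_realization)
    have f_eq_None: "f z = None \<longleftrightarrow> supp z \<in> L" if "z \<in> topspace ?X" for z
      using cases_K[OF that]
    proof
      assume "\<exists>i<k. supp z = R i"
      then obtain i where "i < k" "supp z = R i" by blast
      then show ?thesis using f_Some[of i z] notin[of i] by simp
    qed (use f_None[of z] in simp)
    have "x = x'" if eq: "f x = f x'" and out: "supp x \<notin> L"
    proof -
      have "supp x' \<notin> L" using that x f_eq_None by metis
      then obtain i j where i: "i < k" "supp x = R i" and j: "j < k" "supp x' = R j"
        using cases_K[OF x(1)] cases_K[OF x(2)] out by blast
      have [simp]: "j = i" and \<zeta>: "\<zeta> i x = \<zeta> i x'"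
        using eq f_Some[OF i] f_Some[OF j] by auto
      have C: "x \<in> topspace (?C i)" "x' \<in> topspace (?C i)" using in_C x i j by auto
      have y: "y i x j = y i x' j" if "j \<le> d" for j
      proof (rule simplex_chart_inj[OF sum_y[OF i(1) C(1)] _ sum_y[OF i(1) C(2)] _ _ that])
        show "0 < least_coord d (y i x)" unfolding least_pos[OF i(1) C(1)] by (rule i(2))
        show "0 < least_coord d (y i x')" unfolding least_pos[OF i(1) C(2)] using j(2) by simp
        show "simplex_chart d (y i x) = simplex_chart d (y i x')" using \<zeta> by (simp add: \<zeta>_def)
      qed
      have "x v = x' v" for v
      proof (cases "v \<in> R i")
        case True
        then obtain l where "l \<le> d" "v = e i l" using e[OF i(1)] by (auto simp: bij_betw_def)
        then show ?thesis using y[of l] by (simp add: y_def)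
      next
        case False
        then have "v \<notin> supp x" "v \<notin> supp x'" unfolding i(2) j(2) by simp_all
        then show ?thesis by simp
      qed
      then show ?thesis by blast
    qed
    then show ?thesis
      using in_Y x f_eq_None by metis
  qed
  show ?thesis
    by (rule homotopy_equivalent_quotient[OF q fibres \<Phi>])
qed

section \<open>Combinatorial Alexander duality\<close>

definition alexander_dual :: "'a set \<Rightarrow> 'a set set \<Rightarrow> 'a set set" where
  "alexander_dual V C = {\<tau>. \<tau> \<subseteq> V \<and> V - \<tau> \<notin> C}"

definition down_closed :: "'a set set \<Rightarrow> bool" where
  "down_closed C \<longleftrightarrow> (\<forall>\<rho>\<in>C. \<forall>\<tau>\<subseteq>\<rho>. \<tau> \<in> C)"

lemma down_closed_Un_Pow: "down_closed C \<Longrightarrow> down_closed (C \<union> Pow S)"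
  by (auto simp: down_closed_def)

lemma abstract_complex_alexander_dual:
  assumes "finite V" and "down_closed C"
  shows "abstract_complex (alexander_dual V C)"
proof -
  have "V - \<rho> \<in> C" if "V - \<tau> \<in> C" "\<tau> \<subseteq> \<rho>" for \<rho> \<tau>
    using that assms(2) Diff_mono[of V V \<tau> \<rho>] by (auto simp: down_closed_def)
  then show ?thesis
    using assms(1) by (auto simp: abstract_complex_def alexander_dual_def intro: finite_subset)
qed

lemma alexander_dual_mono: "C \<subseteq> D \<Longrightarrow> alexander_dual V D \<subseteq> alexander_dual V C"
  by (auto simp: alexander_dual_def)

text \<open>Filling a cone of \<open>C\<close> by a simplex is a collapse of the dual complex.\<close>

lemma alexander_dual_fill_cone:
  assumes V: "finite V" and C: "down_closed C" and S: "S \<subset> V" and v: "v \<in> S"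
    and cone: "\<And>\<eta>. \<eta> \<in> C \<Longrightarrow> \<eta> \<subseteq> S \<Longrightarrow> insert v \<eta> \<in> C"
  shows "geometric_realization (alexander_dual V C) homotopy_equivalent_space
         geometric_realization (alexander_dual V (C \<union> Pow S))"
proof -
  let ?K = "alexander_dual V C"
  have "geometric_realization ?K homotopy_equivalent_space
      geometric_realization {\<rho> \<in> ?K. \<not> V - S \<subseteq> \<rho>}"
  \<comment> \<open>The collapsed face is \<open>V - S\<close>, nonempty because \<open>S\<close> is
    a proper subset. The faces containing it are those with complement inside \<open>S\<close>.
    Inserting \<open>v\<close> into a face deletes \<open>v\<close> from its complement, and by the
    cone condition this cannot turn a nonface of \<open>C\<close> into a face.\<close>
  proof (rule collapse[OF abstract_complex_alexander_dual[OF V C]])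
    show "finite (V - S)" "V - S \<noteq> {}" "v \<notin> V - S" using V S v by auto
    fix \<rho> assume \<rho>: "\<rho> \<in> ?K" "V - S \<subseteq> \<rho>"
    have "V - insert v \<rho> \<notin> C"
    proof
      assume "V - insert v \<rho> \<in> C"
      then have "insert v (V - insert v \<rho>) \<in> C" using \<rho>(2) by (intro cone) auto
      moreover have "V - \<rho> \<subseteq> insert v (V - insert v \<rho>)" by auto
      ultimately have "V - \<rho> \<in> C" using C by (auto simp: down_closed_def)
      then show False using \<rho>(1) by (simp add: alexander_dual_def)
    qed
    then show "insert v \<rho> \<in> ?K" using \<rho>(1) S v by (auto simp: alexander_dual_def)
  qed
  also have "{\<rho> \<in> ?K. \<not> V - S \<subseteq> \<rho>} = alexander_dual V (C \<union> Pow S)"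
    by (auto simp: alexander_dual_def)
  finally show ?thesis .
qed

text \<open>The dual of a cone is a cone with the same apex: if deleting \<open>v\<close> from a
  nonface left a face, inserting \<open>v\<close> again would make the nonface a face. That
  \<open>V\<close> is a nonface puts the empty set, hence also \<open>{v}\<close>, into the
  dual.\<close>

lemma contractible_alexander_dual_cone:
  assumes V: "finite V" and C: "down_closed C" and v: "v \<in> V" and proper: "V \<notin> C"
    and cone: "\<And>\<eta>. \<eta> \<in> C \<Longrightarrow> \<eta> \<subseteq> V \<Longrightarrow> insert v \<eta> \<in> C"
  shows "contractible_space (geometric_realization (alexander_dual V C))"
    and "topspace (geometric_realization (alexander_dual V C)) \<noteq> {}"
proof -
  note K = abstract_complex_alexander_dual[OF V C]
  have ins: "insert v \<rho> \<in> alexander_dual V C" if \<rho>: "\<rho> \<in> alexander_dual V C" for \<rho>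
  proof -
    have "V - insert v \<rho> \<notin> C"
    proof
      assume "V - insert v \<rho> \<in> C"
      then have "insert v (V - insert v \<rho>) \<in> C" by (intro cone) auto
      moreover have "V - \<rho> \<subseteq> insert v (V - insert v \<rho>)" by auto
      ultimately have "V - \<rho> \<in> C" using C by (auto simp: down_closed_def)
      then show False using \<rho> by (simp add: alexander_dual_def)
    qed
    then show ?thesis using \<rho> v by (auto simp: alexander_dual_def)
  qed
  have "{} \<in> alexander_dual V C" using proper by (simp add: alexander_dual_def)
  from ins[OF this] have sing: "{v} \<in> alexander_dual V C" .
  show "contractible_space (geometric_realization (alexander_dual V C))"
    by (rule contractible_realization_cone[OF K sing ins])
  have "(\<lambda>u. if u = v then 1 else 0) \<in> topspace (geometric_realization (alexander_dual V C))"
    by (rule realizationI[OF K sing]) auto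
  then show "topspace (geometric_realization (alexander_dual V C)) \<noteq> {}" by blast
qed

text \<open>A facet is the complement of two distinct nonadjacent vertices, so a set lies in a facet
  iff its complement contains such a pair.\<close>

lemma total_2cut_complex_eq:
  assumes "pair_graph G"
  shows "total_2cut_complex G =
    alexander_dual (pverts G) {\<eta>. \<forall>u\<in>\<eta>. \<forall>v\<in>\<eta>. u \<noteq> v \<longrightarrow> (u, v) \<in> parcs G}"
    (is "_ = alexander_dual ?V ?C")
proof -
  interpret pair_graph G by fact
  have sym: "(v, u) \<in> parcs G" if "(u, v) \<in> parcs G" for u v
    using that pair_sym_arcs by (auto simp: symmetric_def sym_def)
  have induced: "arcs (with_proj G \<restriction> A) = {(u, v) \<in> parcs G. u \<in> A \<and> v \<in> A}" for A
    by (auto simp: induce_subgraph_def)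
  have finV: "finite ?V" by (rule pair_finite_verts)
  show ?thesis
  proof (intro equalityI subsetI)
    fix \<tau> assume "\<tau> \<in> total_2cut_complex G"
    then obtain \<sigma> where \<sigma>: "\<sigma> \<subseteq> ?V" "card \<sigma> + 2 = card ?V" "\<tau> \<subseteq> \<sigma>"
      and indep: "{(u, v) \<in> parcs G. u \<in> ?V - \<sigma> \<and> v \<in> ?V - \<sigma>} = {}"
      unfolding total_2cut_complex_def total_2cut_facets_def induced by auto
    have "card (?V - \<sigma>) = 2"
      using \<sigma> finV by (simp add: card_Diff_subset finite_subset)
    then obtain u v where uv: "?V - \<sigma> = {u, v}" "u \<noteq> v" by (auto simp: card_2_iff)
    then have "(u, v) \<notin> parcs G" using indep by auto
    moreover have "u \<in> ?V - \<tau>" "v \<in> ?V - \<tau>" using uv \<sigma>(3) by auto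
    ultimately show "\<tau> \<in> alexander_dual ?V ?C"
      using uv(2) \<sigma> by (auto simp: alexander_dual_def)
  next
    fix \<tau> assume \<tau>: "\<tau> \<in> alexander_dual ?V ?C"
    then obtain u v where uv: "u \<in> ?V - \<tau>" "v \<in> ?V - \<tau>" "u \<noteq> v" "(u, v) \<notin> parcs G"
      by (auto simp: alexander_dual_def)
    have loops: "(w, w) \<notin> parcs G" for w using pair_no_loops[of "(w, w)"] by auto
    have eq: "?V - (?V - {u, v}) = {u, v}" using uv by auto
    have "arcs (with_proj G \<restriction> (?V - (?V - {u, v}))) = {}"
      unfolding induced eq using uv(4) sym loops by auto
    moreover have "card (?V - {u, v}) + 2 = card ?V"
    proof -
      have "card {u, v} = 2" using uv(3) by simp
      moreover have "card {u, v} \<le> card ?V" using uv finV by (intro card_mono) auto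
      ultimately show ?thesis using uv finV by (subst card_Diff_subset) auto
    qed
    ultimately have "?V - {u, v} \<in> total_2cut_facets G"
      by (auto simp: total_2cut_facets_def)
    moreover have "\<tau> \<subseteq> ?V - {u, v}" using \<tau> uv by (auto simp: alexander_dual_def)
    ultimately show "\<tau> \<in> total_2cut_complex G" by (auto simp: total_2cut_complex_def)
  qed
qed

section \<open>The clique complex of the product of a complete graph and a path\<close>

definition layer :: "nat \<Rightarrow> nat \<Rightarrow> (nat \<times> nat) set" where
  "layer m i = {..<m} \<times> {i}"

definition layers_upto :: "nat \<Rightarrow> nat \<Rightarrow> (nat \<times> nat) set" where
  "layers_upto m j = {..<m} \<times> {..j}"

definition rung :: "nat \<Rightarrow> nat \<Rightarrow> (nat \<times> nat) set" where
  "rung u i = {(u, i), (u, Suc i)}"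

definition layer_cone :: "nat \<Rightarrow> nat \<Rightarrow> (nat \<times> nat) set" where
  "layer_cone m i = insert (0, i) (layer m (Suc i))"

definition corner :: "nat \<Rightarrow> nat \<Rightarrow> (nat \<times> nat) set" where
  "corner u i = {(0, i), (u, i), (u, Suc i)}"

lemmas face_defs = layer_def layers_upto_def rung_def layer_cone_def corner_def

definition cliques :: "nat \<Rightarrow> nat \<Rightarrow> (nat \<times> nat) set set" where
  "cliques m n = {\<eta>. (\<exists>i<n. \<eta> \<subseteq> layer m i) \<or> (\<exists>u<m. \<exists>i. Suc i < n \<and> \<eta> \<subseteq> rung u i)}"

text \<open>The parameter \<open>j\<close> counts the layer cones already filled, for the induction.
  The value n - 1 gives C_1 of the overview, and \<open>filled_cliques\<close> is C'.\<close>

definition coned_cliques :: "nat \<Rightarrow> nat \<Rightarrow> nat \<Rightarrow> (nat \<times> nat) set set" where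
  "coned_cliques m n j = cliques m n \<union> {\<eta>. \<exists>i<j. \<eta> \<subseteq> layer_cone m i}"

definition filled_cliques :: "nat \<Rightarrow> nat \<Rightarrow> (nat \<times> nat) set set" where
  "filled_cliques m n = coned_cliques m n (n - 1) \<union>
     {\<eta>. \<exists>u i. 0 < u \<and> u < m \<and> Suc i < n \<and> \<eta> \<subseteq> corner u i}"

lemma down_closed_cliques: "down_closed (cliques m n)"
  unfolding down_closed_def cliques_def by blast

lemma down_closed_coned_cliques: "down_closed (coned_cliques m n j)"
  using down_closed_cliques unfolding down_closed_def coned_cliques_def by blast

lemma down_closed_filled_cliques: "down_closed (filled_cliques m n)"
  using down_closed_coned_cliques unfolding down_closed_def filled_cliques_def by blast

lemma coned_cliques_Suc: "coned_cliques m n (Suc j) = coned_cliques m n j \<union> Pow (layer_cone m j)"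
  unfolding coned_cliques_def by (auto simp: less_Suc_eq)

section \<open>Cliques of the product graph\<close>

lemma adjacent_iff:
  "((u, i), (w, j)) \<in> parcs (complete_graph m \<box> path_graph n) \<longleftrightarrow>
     u < m \<and> w < m \<and> i < n \<and> j < n \<and>
     (u = w \<and> (j = Suc i \<or> i = Suc j) \<or> i = j \<and> u \<noteq> w)"
  by (auto simp: cartesian_product_def complete_graph_def path_graph_def)

text \<open>Two vertices of a clique in different layers are the ends of a rung, and no third vertex
  is adjacent to both ends, so such a clique is contained in the rung.\<close>

lemma clique_iff:
  assumes n: "0 < n" and sub: "\<eta> \<subseteq> {..<m} \<times> {..<n}"
  shows "(\<forall>a\<in>\<eta>. \<forall>b\<in>\<eta>. a \<noteq> b \<longrightarrow> (a, b) \<in> parcs (complete_graph m \<box> path_graph n)) \<longleftrightarrow>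
    \<eta> \<in> cliques m n"
    (is "?clique \<longleftrightarrow> _")
proof
  assume clique: ?clique
  have adj: "u = w \<and> (j = Suc i \<or> i = Suc j) \<or> i = j"
    if "(u, i) \<in> \<eta>" "(w, j) \<in> \<eta>" for u i w j
  proof (cases "(u, i) = (w, j)")
    case False
    then have "((u, i), (w, j)) \<in> parcs (complete_graph m \<box> path_graph n)"
      using clique that by blast
    then show ?thesis unfolding adjacent_iff by blast
  qed simp
  show "\<eta> \<in> cliques m n"
  proof (cases "\<exists>i. \<eta> \<subseteq> {..<m} \<times> {i}")
    case True
    then obtain i where i: "\<eta> \<subseteq> {..<m} \<times> {i}" by blast
    show ?thesis
    \<comment> \<open>The empty clique does not determine a layer; it is a face because some layer
      exists.\<close>
    proof (cases "\<eta> = {}")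
      case False
      then have "i < n" using i sub by auto
      then show ?thesis using i by (auto simp: cliques_def layer_def)
    qed (use n in \<open>auto simp: cliques_def\<close>)
  next
    case False
    then obtain a where a: "a \<in> \<eta>" by blast
    from False have "\<not> \<eta> \<subseteq> {..<m} \<times> {snd a}" by blast
    then obtain b where b: "b \<in> \<eta>" "b \<notin> {..<m} \<times> {snd a}" by blast
    obtain u i w j where [simp]: "a = (u, i)" "b = (w, j)" by fastforce
    have ui: "(u, i) \<in> \<eta>" and wj: "(w, j) \<in> \<eta>" and "i \<noteq> j"
      using a b subsetD[OF sub b(1)] by auto
    then have "\<exists>u i. (u, i) \<in> \<eta> \<and> (u, Suc i) \<in> \<eta>"
      using adj[OF ui wj] by auto
    then obtain u i where u: "(u, i) \<in> \<eta>" "(u, Suc i) \<in> \<eta>" by blast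
    have "\<eta> \<subseteq> rung u i"
    proof
      fix a assume "a \<in> \<eta>"
      moreover obtain z l where [simp]: "a = (z, l)" by fastforce
      ultimately show "a \<in> rung u i"
        using adj[OF u(1), of z l] adj[OF u(2), of z l] by (auto simp: rung_def)
    qed
    moreover have "u < m" "Suc i < n" using u sub by auto
    ultimately show ?thesis unfolding cliques_def by blast
  qed
next
  assume "\<eta> \<in> cliques m n"
  then show ?clique
    unfolding cliques_def
  proof (elim CollectE disjE exE conjE)
    fix i assume "i < n" "\<eta> \<subseteq> layer m i"
    show ?clique
    proof (intro ballI impI)
      fix a b assume "a \<in> \<eta>" "b \<in> \<eta>" "a \<noteq> b"
      then show "(a, b) \<in> parcs (complete_graph m \<box> path_graph n)"
        using subsetD[OF \<open>\<eta> \<subseteq> layer m i\<close>, of a] subsetD[OF \<open>\<eta> \<subseteq> layer m i\<close>, of b] \<open>i < n\<close>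
        by (cases a; cases b) (simp add: layer_def adjacent_iff)
    qed
  next
    fix u i assume "u < m" "Suc i < n" "\<eta> \<subseteq> rung u i"
    show ?clique
    proof (intro ballI impI)
      fix a b assume "a \<in> \<eta>" "b \<in> \<eta>" "a \<noteq> b"
      then show "(a, b) \<in> parcs (complete_graph m \<box> path_graph n)"
        using subsetD[OF \<open>\<eta> \<subseteq> rung u i\<close>, of a] subsetD[OF \<open>\<eta> \<subseteq> rung u i\<close>, of b]
          \<open>u < m\<close> \<open>Suc i < n\<close>
        by (cases a; cases b) (auto simp: rung_def adjacent_iff)
    qed
  qed
qed

lemma total_2cut_complex_product:
  assumes "0 < n"
  shows "total_2cut_complex (complete_graph m \<box> path_graph n) =
    alexander_dual ({..<m} \<times> {..<n}) (cliques m n)"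
proof -
  have V: "pverts (complete_graph m \<box> path_graph n) = {..<m} \<times> {..<n}"
    by (simp add: cartesian_product_def complete_graph_def path_graph_def)
  show ?thesis
    unfolding total_2cut_complex_eq[OF pair_graph_cartesian_product[OF
          pair_graph_complete_graph pair_graph_path_graph]] V alexander_dual_def
    using clique_iff[OF assms] by auto
qed

text \<open>The apex is (0,j+1). A face avoiding (0,j) lies in layer j+1, which is a simplex. A face
  containing (0,j) can meet layer j+1 only in the apex: the rung at 0 is the only link, as the cones
  filled so far reach no higher than layer j.\<close>

lemma cone_step_layer:
  assumes m: "0 < m" and j: "Suc j < n"
    and \<eta>: "\<eta> \<in> coned_cliques m n j" "\<eta> \<subseteq> layer_cone m j"
  shows "insert (0, Suc j) \<eta> \<in> coned_cliques m n j"
proof (cases "(0, j) \<in> \<eta>")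
  case False
  then have "insert (0, Suc j) \<eta> \<subseteq> layer m (Suc j)"
    using \<eta>(2) m by (auto simp: layer_cone_def layer_def)
  then show ?thesis using j by (auto simp: coned_cliques_def cliques_def)
next
  case True
  have "z = 0" if "(z, Suc j) \<in> \<eta>" for z
  proof -
    consider i where "\<eta> \<subseteq> layer m i" | u i where "\<eta> \<subseteq> rung u i"
      | i where "i < j" "\<eta> \<subseteq> layer_cone m i"
      using \<eta>(1) unfolding coned_cliques_def cliques_def by blast
    then show ?thesis
    proof cases
      case (1 i)
      show ?thesis using subsetD[OF 1 True] subsetD[OF 1 that] by (simp add: face_defs)
    next
      case (2 u i)
      show ?thesis using subsetD[OF 2 True] subsetD[OF 2 that] by (auto simp: face_defs)
    next
      case (3 i)
      show ?thesis using subsetD[OF 3(2) True] subsetD[OF 3(2) that] 3(1) by (auto simp: face_defs)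
    qed
  qed
  then have "insert (0, Suc j) \<eta> \<subseteq> rung 0 j"
    using \<eta>(2) by (auto simp: face_defs)
  then show ?thesis using j m by (auto simp: coned_cliques_def cliques_def)
qed

text \<open>Each alternative other than \<open>layers_upto m j\<close> is a face containing (0,j),
  as \<open>cone_step_filled\<close> requires. Generators based above layer j meet the region only
  in layer j+1, which is part of \<open>layer_cone m j\<close>.\<close>

lemma filled_clique_cases:
  assumes \<eta>: "\<eta> \<in> filled_cliques m n" "\<eta> \<subseteq> layers_upto m (Suc j)"
  shows "\<eta> \<subseteq> layers_upto m j \<or> \<eta> \<subseteq> layer_cone m j \<or> (\<exists>u>0. u < m \<and> \<eta> \<subseteq> corner u j)"
proof -
  have layer: ?thesis if "\<eta> \<subseteq> layer m i" for i
  proof (cases "i \<le> j")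
    case True
    then have "\<eta> \<subseteq> layers_upto m j" using that by (auto simp: face_defs)
    then show ?thesis by blast
  next
    case False
    then have "\<eta> \<subseteq> layer_cone m j" using that \<eta>(2) by (fastforce simp: face_defs)
    then show ?thesis by blast
  qed
  have rung: ?thesis if "\<eta> \<subseteq> rung u i" "u < m" for u i
  proof (cases i j rule: linorder_cases)
    case less
    then have "\<eta> \<subseteq> layers_upto m j" using that by (auto simp: face_defs)
    then show ?thesis by blast
  next
    case equal
    then have "\<eta> \<subseteq> corner u j" using that by (auto simp: face_defs)
    moreover have "\<eta> \<subseteq> layer_cone m j" if "u = 0"
      using equal \<open>\<eta> \<subseteq> rung u i\<close> \<open>u < m\<close> that by (auto simp: face_defs)
    ultimately show ?thesis using that(2) by blast
  next
    case greater
    then have "\<eta> \<subseteq> layer_cone m j" using that \<eta>(2) by (fastforce simp: face_defs)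
    then show ?thesis by blast
  qed
  have cone: ?thesis if "\<eta> \<subseteq> layer_cone m i" for i
  proof (cases i j rule: linorder_cases)
    case less
    then have "\<eta> \<subseteq> layers_upto m j" using that \<eta>(2) by (fastforce simp: face_defs)
    then show ?thesis by blast
  next
    case equal
    then show ?thesis using that by blast
  next
    case greater
    then have "\<eta> \<subseteq> layer_cone m j" using that \<eta>(2) by (fastforce simp: face_defs)
    then show ?thesis by blast
  qed
  have corner: ?thesis if "\<eta> \<subseteq> corner u i" "0 < u" "u < m" for u i
  proof (cases i j rule: linorder_cases)
    case less
    then have "\<eta> \<subseteq> layers_upto m j" using that by (auto simp: face_defs)
    then show ?thesis by blast
  next
    case equal
    then show ?thesis using that by blast
  next
    case greater
    then have "\<eta> \<subseteq> layer_cone m j" using that \<eta>(2) by (fastforce simp: face_defs)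
    then show ?thesis by blast
  qed
  show ?thesis
    using \<eta>(1) layer rung cone corner
    unfolding filled_cliques_def coned_cliques_def cliques_def by blast
qed

text \<open>The apex (0,j) belongs to each of the three kinds of sets in
  \<open>filled_clique_cases\<close>, so inserting it leads to no larger set.\<close>

lemma cone_step_filled:
  assumes m: "0 < m" and j: "Suc j < n"
    and \<eta>: "\<eta> \<in> filled_cliques m n \<union> Pow (layers_upto m j)" "\<eta> \<subseteq> layers_upto m (Suc j)"
  shows "insert (0, j) \<eta> \<in> filled_cliques m n \<union> Pow (layers_upto m j)"
proof -
  have "\<eta> \<subseteq> layers_upto m j \<or> \<eta> \<subseteq> layer_cone m j \<or> (\<exists>u>0. u < m \<and> \<eta> \<subseteq> corner u j)"
    using \<eta> filled_clique_cases[of \<eta> m n j] by blast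
  then show ?thesis
  proof (elim disjE exE conjE)
    assume "\<eta> \<subseteq> layers_upto m j"
    then show ?thesis using m by (simp add: layers_upto_def)
  next
    assume "\<eta> \<subseteq> layer_cone m j"
    then have "insert (0, j) \<eta> \<subseteq> layer_cone m j" by (simp add: layer_cone_def)
    moreover have "j < n - 1" using j by simp
    ultimately show ?thesis unfolding filled_cliques_def coned_cliques_def by blast
  next
    fix u assume u: "0 < u" "u < m" "\<eta> \<subseteq> corner u j"
    then have "insert (0, j) \<eta> \<subseteq> corner u j" by (simp add: corner_def)
    then show ?thesis using u j unfolding filled_cliques_def by blast
  qed
qed

text \<open>The initial blocks of layers are filled one after another, each being a cone with its
  apex in the layer below its top one. Filling needs a proper subset of the vertex set, so it stops
  at layer n - 2; the complex obtained is then itself a cone with apex (0,n-2).\<close>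

lemma contractible_filled_cliques:
  assumes m: "2 \<le> m" and n: "2 \<le> n"
  shows "contractible_space (geometric_realization
           (alexander_dual ({..<m} \<times> {..<n}) (filled_cliques m n)))"
    and "topspace (geometric_realization
           (alexander_dual ({..<m} \<times> {..<n}) (filled_cliques m n))) \<noteq> {}"
proof -
  let ?V = "{..<m} \<times> {..<n}"
  let ?D = "\<lambda>j. filled_cliques m n \<union> Pow (layers_upto m j)"
  let ?R = "\<lambda>C. geometric_realization (alexander_dual ?V C)"
  have V: "finite ?V" by simp
  have V_eq: "?V = layers_upto m (Suc (n - 2))"
    using n by (auto simp: layers_upto_def)
  have closed: "down_closed (?D j)" for j
    by (rule down_closed_Un_Pow[OF down_closed_filled_cliques])
  have "layers_upto m 0 = layer m 0" by (auto simp: face_defs)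
  then have "Pow (layers_upto m 0) \<subseteq> filled_cliques m n"
    using n unfolding filled_cliques_def coned_cliques_def cliques_def by auto
  then have D0: "?D 0 = filled_cliques m n" by blast
  have equiv: "?R (filled_cliques m n) homotopy_equivalent_space ?R (?D j)" if "j \<le> n - 2" for j
    using that
  proof (induction j)
    case 0
    show ?case unfolding D0 by (rule homotopy_equivalent_space_refl)
  next
    case (Suc j)
    have "?R (?D j) homotopy_equivalent_space ?R (?D j \<union> Pow (layers_upto m (Suc j)))"
    proof (rule alexander_dual_fill_cone[OF V closed])
      have "(0, n - 1) \<in> ?V - layers_upto m (Suc j)" "layers_upto m (Suc j) \<subseteq> ?V"
        using Suc.prems m n by (auto simp: layers_upto_def)
      then show "layers_upto m (Suc j) \<subset> ?V" by blast
      show "(0, j) \<in> layers_upto m (Suc j)" using m by (simp add: layers_upto_def)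
      show "insert (0, j) \<eta> \<in> ?D j" if "\<eta> \<in> ?D j" "\<eta> \<subseteq> layers_upto m (Suc j)" for \<eta>
        using that Suc.prems m by (intro cone_step_filled) auto
    qed
    also have "?D j \<union> Pow (layers_upto m (Suc j)) = ?D (Suc j)"
      by (fastforce simp: layers_upto_def)
    finally show ?case using Suc by (auto intro: homotopy_eqv_trans)
  qed
  let ?E = "?D (n - 2)"
  have v: "(0, n - 2) \<in> ?V" using m n by simp
  have cone: "insert (0, n - 2) \<eta> \<in> ?E" if "\<eta> \<in> ?E" "\<eta> \<subseteq> ?V" for \<eta>
    using that m n unfolding V_eq by (intro cone_step_filled) auto
  \<comment> \<open>No generating simplex contains all three of these vertices, so the whole vertex
    set is not a face.\<close>
  have corners: "(0, 0) \<in> ?V" "(1, 0) \<in> ?V" "(0, n - 1) \<in> ?V" using m n by auto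
  have proper: "?V \<notin> ?E"
  proof
    assume "?V \<in> ?E"
    then consider i where "?V \<subseteq> layer m i" | u i where "?V \<subseteq> rung u i"
      | i where "?V \<subseteq> layer_cone m i"
      | u i where "?V \<subseteq> corner u i" "0 < u" "Suc i < n" | "?V \<subseteq> layers_upto m (n - 2)"
      unfolding filled_cliques_def coned_cliques_def cliques_def by blast
    then show False
    proof cases
      case (1 i)
      then show ?thesis using subsetD[OF 1 corners(1)] subsetD[OF 1 corners(3)] n
        by (simp add: face_defs)
    next
      case (2 u i)
      then show ?thesis using subsetD[OF 2 corners(1)] subsetD[OF 2 corners(2)]
        by (auto simp: face_defs)
    next
      case (3 i)
      then show ?thesis using subsetD[OF 3 corners(2)] by (simp add: face_defs)
    next
      case (4 u i)
      then show ?thesis using subsetD[OF 4(1) corners(3)] by (auto simp: face_defs)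
    next
      case 5
      then show ?thesis using subsetD[OF 5 corners(3)] n by (auto simp: face_defs)
    qed
  qed
  note E = contractible_alexander_dual_cone[OF V closed v proper cone]
  show "contractible_space (?R (filled_cliques m n))"
    using homotopy_equivalent_space_contractibility[OF equiv[OF order_refl]] E(1) by blast
  \<comment> \<open>Filling only shrinks the dual, so a point of the final dual is also a point of
    the original one.\<close>
  show "topspace (?R (filled_cliques m n)) \<noteq> {}"
    using E(2) realization_mono[OF alexander_dual_mono[of "filled_cliques m n" ?E ?V]] by blast
qed

section \<open>The missing triangles and the cells dual to them\<close>

lemma corner_subset:
  "0 < u \<Longrightarrow> corner u i \<subseteq> corner w l \<Longrightarrow> u = w \<and> i = l"
  by (auto simp: corner_def)

text \<open>A corner has two vertices in layer i and one in layer i+1. Rungs and layer cones have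
  only one vertex in their lower layer, and a layer has no second level.\<close>

lemma corner_notin_coned_cliques: "0 < u \<Longrightarrow> corner u i \<notin> coned_cliques m n j"
  by (auto simp: coned_cliques_def cliques_def face_defs)

text \<open>The three edges come from three sources: a rung, a layer, and, for the diagonal from
  (0,i) to (u,i+1), a filled layer cone.\<close>

lemma proper_subset_corner:
  assumes u: "u < m" and i: "Suc i < n" and \<eta>: "\<eta> \<subset> corner u i"
  shows "\<eta> \<in> coned_cliques m n (n - 1)"
proof -
  have "\<eta> \<subseteq> layer m i \<or> \<eta> \<subseteq> rung u i \<or> \<eta> \<subseteq> layer_cone m i"
  proof -
    obtain a where "a \<in> corner u i" "a \<notin> \<eta>" using \<eta> by blast
    then consider "(0, i) \<notin> \<eta>" | "(u, i) \<notin> \<eta>" | "(u, Suc i) \<notin> \<eta>"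
      by (auto simp: corner_def)
    then show ?thesis
    proof cases
      case 1
      then have "\<eta> \<subseteq> rung u i" using \<eta> by (auto simp: corner_def rung_def)
      then show ?thesis by blast
    next
      case 2
      then have "\<eta> \<subseteq> layer_cone m i" using \<eta> u by (auto simp: face_defs)
      then show ?thesis by blast
    next
      case 3
      then have "\<eta> \<subseteq> layer m i" using \<eta> u by (auto simp: face_defs)
      then show ?thesis by blast
    qed
  qed
  moreover have "i < n" "i < n - 1" using i by auto
  ultimately show ?thesis using u i unfolding coned_cliques_def cliques_def by blast
qed

lemma coned_cliques_equiv:
  assumes m: "2 \<le> m" and j: "j \<le> n - 1"
  shows "geometric_realization (alexander_dual ({..<m} \<times> {..<n}) (cliques m n))
    homotopy_equivalent_space
    geometric_realization (alexander_dual ({..<m} \<times> {..<n}) (coned_cliques m n j))"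
  using j
proof (induction j)
  case 0
  show ?case by (simp add: coned_cliques_def homotopy_equivalent_space_refl)
next
  case (Suc j)
  let ?V = "{..<m} \<times> {..<n}"
  have "geometric_realization (alexander_dual ?V (coned_cliques m n j)) homotopy_equivalent_space
      geometric_realization (alexander_dual ?V (coned_cliques m n j \<union> Pow (layer_cone m j)))"
  proof (rule alexander_dual_fill_cone[OF _ down_closed_coned_cliques])
    \<comment> \<open>The vertex (1,j), available as m \<ge> 2, shows that the cone is a proper
      subset.\<close>
    have "(1, j) \<in> ?V - layer_cone m j" "layer_cone m j \<subseteq> ?V"
      using Suc.prems m by (auto simp: face_defs)
    then show "layer_cone m j \<subset> ?V" by blast
    show "(0, Suc j) \<in> layer_cone m j" using m by (simp add: face_defs)
    show "insert (0, Suc j) \<eta> \<in> coned_cliques m n j"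
      if "\<eta> \<in> coned_cliques m n j" "\<eta> \<subseteq> layer_cone m j" for \<eta>
      using that Suc.prems m by (intro cone_step_layer) auto
  qed simp
  then show ?case using Suc unfolding coned_cliques_Suc by (auto intro: homotopy_eqv_trans)
qed

text \<open>The cells are the complements of the corners, attached to the contractible dual of
  \<open>filled_cliques\<close>. They are indexed by u from 1 to m - 1 and i from 0 to n - 2, which
  gives the number of spheres.\<close>

lemma dual_coned_cliques_equiv:
  assumes m: "2 \<le> m" and n: "2 \<le> n"
  shows "geometric_realization (alexander_dual ({..<m} \<times> {..<n}) (coned_cliques m n (n - 1)))
    homotopy_equivalent_space wedge_of_spheres ((m - 1) * (n - 1)) (m * n - 4)"
proof -
  let ?V = "{..<m} \<times> {..<n}" and ?T = "{1..<m} \<times> {..<n - 1}"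
  let ?C = "coned_cliques m n (n - 1)"
  let ?K = "alexander_dual ?V ?C" and ?L = "alexander_dual ?V (filled_cliques m n)"
  let ?k = "(m - 1) * (n - 1)"
  have "\<exists>g. bij_betw g {..<?k} ?T"
    using ex_bij_betw_nat_finite[of ?T] by (simp add: atLeast0LessThan card_cartesian_product)
  then obtain g where g: "bij_betw g {..<?k} ?T" ..
  define F where "F = (\<lambda>(u, i). ?V - corner u i)"
  let ?R = "\<lambda>t. F (g t)"
  \<comment> \<open>This keeps the truncated subtraction honest: m * n - 3 is then the successor of
    m * n - 4.\<close>
  have mn: "4 \<le> m * n" using mult_le_mono[OF m n] by simp
  have tri_V: "corner u i \<subseteq> ?V" if "(u, i) \<in> ?T" for u i
    using that by (auto simp: corner_def)
  have compl: "?V - F (u, i) = corner u i" if "(u, i) \<in> ?T" for u i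
    using tri_V[OF that] by (auto simp: F_def)
  have tri_filled: "corner u i \<in> filled_cliques m n" if "(u, i) \<in> ?T" for u i
    using that unfolding filled_cliques_def
    by (intro UnI2 CollectI exI[of _ u] exI[of _ i]) auto
  have tri_coned: "corner u i \<notin> ?C" if "(u, i) \<in> ?T" for u i
    using that by (intro corner_notin_coned_cliques) auto
  have g_T: "\<exists>u i. g t = (u, i) \<and> (u, i) \<in> ?T" if "t < ?k" for t
    using bij_betwE[OF g] that by (metis lessThan_iff surj_pair)
  have K_eq: "?K = ?L \<union> F ` ?T"
  proof (intro equalityI subsetI)
    fix \<tau> assume \<tau>: "\<tau> \<in> ?K"
    show "\<tau> \<in> ?L \<union> F ` ?T"
    proof (cases "?V - \<tau> \<in> filled_cliques m n")
      case True
      then obtain u i where ui: "0 < u" "u < m" "Suc i < n" "?V - \<tau> \<subseteq> corner u i"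
        using \<tau> unfolding alexander_dual_def filled_cliques_def by auto
      \<comment> \<open>The complement of a face lost on passing to the smaller dual lies in a
        corner without being a face of \<open>?C\<close>; since all proper subsets of the corner are
        faces, it is the whole corner.\<close>
      have eq: "?V - \<tau> = corner u i"
      proof (rule ccontr)
        assume "?V - \<tau> \<noteq> corner u i"
        with ui(4) have "?V - \<tau> \<in> ?C"
          by (intro proper_subset_corner[OF ui(2,3)]) (rule psubsetI)
        then show False using \<tau> by (simp add: alexander_dual_def)
      qed
      have "\<tau> \<subseteq> ?V" using \<tau> by (simp add: alexander_dual_def)
      then have "\<tau> = ?V - (?V - \<tau>)" by (rule double_diff[OF _ subset_refl, symmetric])
      then have "\<tau> = F (u, i)" unfolding eq by (simp add: F_def)
      moreover have "(u, i) \<in> ?T" using ui by auto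
      ultimately show ?thesis by blast
    qed (use \<tau> in \<open>simp add: alexander_dual_def\<close>)
  next
    fix \<tau> assume "\<tau> \<in> ?L \<union> F ` ?T"
    then show "\<tau> \<in> ?K"
    proof
      assume "\<tau> \<in> ?L"
      moreover have "?C \<subseteq> filled_cliques m n" by (auto simp: filled_cliques_def)
      ultimately show "\<tau> \<in> ?K" using alexander_dual_mono by blast
    next
      assume "\<tau> \<in> F ` ?T"
      then obtain u i where ui: "(u, i) \<in> ?T" "\<tau> = F (u, i)" by auto
      then show "\<tau> \<in> ?K"
        using compl[OF ui(1)] tri_coned[OF ui(1)] unfolding alexander_dual_def
        by (simp add: F_def Diff_subset)
    qed
  qed
  have F_inj: "inj_on F ?T"
  proof (rule inj_onI)
    fix p q assume pq: "p \<in> ?T" "q \<in> ?T" and eq: "F p = F q"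
    obtain u i w l where p: "p = (u, i)" and q: "q = (w, l)" by fastforce
    have "corner u i = corner w l"
      using compl[of u i] compl[of w l] pq eq unfolding p q by simp
    moreover have "0 < u" using pq p by auto
    ultimately show "p = q" using corner_subset[of u i w l] p q by simp
  qed
  show ?thesis
  proof (rule wedge_of_attached_cells[where R = ?R and L = ?L])
    show "abstract_complex ?L"
      by (rule abstract_complex_alexander_dual[OF _ down_closed_filled_cliques]) simp
    show "?K = ?L \<union> ?R ` {..<?k}"
      unfolding K_eq using g by (metis bij_betw_imp_surj_on image_image)
    show "0 < ?k" using m n by simp
    show "inj_on ?R {..<?k}"
      using comp_inj_on[of g "{..<?k}" F] g F_inj by (simp add: bij_betw_def o_def)
    show "contractible_space (geometric_realization ?L)" "topspace (geometric_realization ?L) \<noteq> {}"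
      using contractible_filled_cliques[OF m n] by auto
  next
    fix t assume "t < ?k"
    then obtain u i where g_t: "g t = (u, i)" and T: "(u, i) \<in> ?T" using g_T by blast
    have "card (corner u i) = 3" using T by (simp add: corner_def)
    then have "card (F (u, i)) = m * n - 3"
      using tri_V[OF T] by (simp add: F_def card_Diff_subset finite_subset[OF tri_V[OF T]] card_cartesian_product)
    then show "card (?R t) = Suc (m * n - 4)" using g_t mn by simp
    show "?R t \<notin> ?L"
      using compl[OF T] tri_filled[OF T] g_t by (simp add: alexander_dual_def)
    fix \<tau> assume "\<tau> \<subset> ?R t"
    then have \<tau>: "\<tau> \<subseteq> ?V" "corner u i \<subset> ?V - \<tau>"
      using g_t tri_V[OF T] by (auto simp: F_def)
    have "?V - \<tau> \<notin> ?C"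
      using tri_coned[OF T] \<tau>(2) down_closed_coned_cliques[of m n "n - 1"]
      unfolding down_closed_def by blast
    \<comment> \<open>A complement strictly larger than one corner cannot fit into another, because
      distinct corners are incomparable. So the boundary of each cell lies in
      \<open>?L\<close>.\<close>
    moreover have "\<not> ?V - \<tau> \<subseteq> corner w l" for w l
    proof
      assume w: "?V - \<tau> \<subseteq> corner w l"
      moreover have "0 < u" using T by auto
      ultimately have "u = w \<and> i = l" using \<tau>(2) by (intro corner_subset) auto
      then show False using w \<tau>(2) by auto
    qed
    ultimately show "\<tau> \<in> ?L"
      using \<tau>(1) by (auto simp: alexander_dual_def filled_cliques_def)
  qed
qed

theorem theorem3p12:
  fixes m n :: nat
  assumes "m \<ge> 2" and "n \<ge> 2"
  shows "geometric_realization (total_2cut_complex (complete_graph m \<box> path_graph n))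
           homotopy_equivalent_space wedge_of_spheres ((m - 1) * (n - 1)) (m * n - 4)"
proof -
  have "0 < n" using assms by simp
  show ?thesis
    unfolding total_2cut_complex_product[OF \<open>0 < n\<close>]
    by (rule homotopy_eqv_trans[OF coned_cliques_equiv[OF assms(1) order_refl]
          dual_coned_cliques_equiv[OF assms]])
qed

end
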